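(* Let $A$ be a coercive self-adjoint operator on an infinite-dimensional real Hilbert space $H$ with $A^{-1}$ compact, with eigenvalues $(\lambda_n)_{n\ge1}$, and let $V=D(A^{1/2})$. Assume: (i) for some $\varepsilon>0$, $\delta>0$, one has $\lambda_n\ge\delta n^{\varepsilon}$ for all $n\ge1$; (ii) for some $C>1$, one has $\lambda_{n+1}\le C\lambda_n$ for all $n\ge1$. Let $c>0$ and $\alpha\in(0,1/2)$. Then there exist a solution $u$ of $$u''+Au+cA^{\alpha}u'=0$$ with initial data $u(0)=u_0$, $u'(0)=u_1$, $(u_0,u_1)\in V\times H$, an integer $n_0\ge1$, and a function $(t,\theta)\mapsto\delta(t,\theta)>0$ defined for $0<t<\theta$ (unrelated to the constant in (i)) such that $$\forall k\ge n_0\ (k\in\mathbb{N}),\ \forall t>0,\ \forall\theta>t,\quad \int_t^{\theta}|A^ku(s)|^2\,ds\ge[\delta(t,\theta)\,k]^{\frac{2k}{\alpha}}.$$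
   Context: $|\cdot|$ and $(\cdot,\cdot)$ denote the norm and inner product of $H$. "Coercive" means there is $a>0$ with $(Aw,w)\ge a|w|^2$ for all $w\in D(A)$. $(\lambda_n)_{n\ge1}$ is the nondecreasing sequence of eigenvalues of $A$, repeated according to multiplicity. Fractional powers are defined by the spectral theorem. Solutions are understood in the energy space: $u\in C([0,\infty);V)\cap C^1([0,\infty);H)$ and, for every $w\in D(A)$, the function $t\mapsto (u'(t),w)$ is $C^1$ on $[0,\infty)$ with $\frac{d}{dt}(u'(t),w)+(u(t),Aw)+c\,(u'(t),A^{\alpha}w)=0$; for each $(u_0,u_1)\in V\times H$ there is exactly one such solution with $u(0)=u_0$, $u'(0)=u_1$. For every such solution, $u(t)\in D(A^k)$ for all $k\in\mathbb{N}$ and $t>0$. *)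

theory Defs
  imports "HOL-Analysis.Analysis"
begin

text \<open>
  An unbounded operator on \<open>H\<close> is a pair of a domain \<open>D\<close> and a total function \<open>A\<close>
  of which only the values on \<open>D\<close> matter.
\<close>

definition densely_defined_operator :: "'a::real_inner set \<Rightarrow> ('a \<Rightarrow> 'a) \<Rightarrow> bool" where
  "densely_defined_operator D A \<longleftrightarrow>
     subspace D \<and> closure D = UNIV \<and>
     (\<forall>x\<in>D. \<forall>y\<in>D. A (x + y) = A x + A y) \<and>
     (\<forall>r. \<forall>x\<in>D. A (r *\<^sub>R x) = r *\<^sub>R A x)"

definition adjoint_domain :: "'a::real_inner set \<Rightarrow> ('a \<Rightarrow> 'a) \<Rightarrow> 'a set" where
  "adjoint_domain D A = {y. \<exists>z. \<forall>x\<in>D. A x \<bullet> y = x \<bullet> z}"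

text \<open>\<open>A\<^sup>* = A\<close>: the domains agree, and symmetry says that the values do.\<close>

definition self_adjoint :: "'a::real_inner set \<Rightarrow> ('a \<Rightarrow> 'a) \<Rightarrow> bool" where
  "self_adjoint D A \<longleftrightarrow>
     densely_defined_operator D A \<and> adjoint_domain D A = D \<and>
     (\<forall>x\<in>D. \<forall>y\<in>D. A x \<bullet> y = x \<bullet> A y)"

definition coercive :: "'a::real_inner set \<Rightarrow> ('a \<Rightarrow> 'a) \<Rightarrow> bool" where
  "coercive D A \<longleftrightarrow> (\<exists>a>0. \<forall>w\<in>D. A w \<bullet> w \<ge> a * (norm w)\<^sup>2)"

definition compact_operator :: "('a::real_normed_vector \<Rightarrow> 'a) \<Rightarrow> bool" where
  "compact_operator T \<longleftrightarrow> linear T \<and> compact (closure (T ` cball 0 1))"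

definition has_compact_inverse :: "'a::real_normed_vector set \<Rightarrow> ('a \<Rightarrow> 'a) \<Rightarrow> bool" where
  "has_compact_inverse D A \<longleftrightarrow> bij_betw A D UNIV \<and> compact_operator (inv_into D A)"

definition eigenspace :: "'a::real_vector set \<Rightarrow> ('a \<Rightarrow> 'a) \<Rightarrow> real \<Rightarrow> 'a set" where
  "eigenspace D A \<mu> = {x \<in> D. A x = \<mu> *\<^sub>R x}"

definition eigenvalues :: "'a::real_vector set \<Rightarrow> ('a \<Rightarrow> 'a) \<Rightarrow> real set" where
  "eigenvalues D A = {\<mu>. \<exists>x\<in>eigenspace D A \<mu>. x \<noteq> 0}"

text \<open>
  The eigenvalues \<open>ev 1 \<le> ev 2 \<le> \<dots>\<close>, each real number \<open>\<mu>\<close> being taken exactly as often as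
  the dimension of its eigenspace (zero times if it is not an eigenvalue). The value \<open>ev 0\<close> is
  irrelevant. A finite basis is asked for explicitly because \<open>dim\<close> is 0 on
  infinite-dimensional subspaces.
\<close>

definition eigenvalue_sequence :: "'a::real_vector set \<Rightarrow> ('a \<Rightarrow> 'a) \<Rightarrow> (nat \<Rightarrow> real) \<Rightarrow> bool" where
  "eigenvalue_sequence D A ev \<longleftrightarrow>
     mono_on {1..} ev \<and>
     (\<forall>\<mu>. finite {n. n \<ge> 1 \<and> ev n = \<mu>} \<and>
        (\<exists>B. finite B \<and> independent B \<and> span B = eigenspace D A \<mu> \<and>
             card B = card {n. n \<ge> 1 \<and> ev n = \<mu>}))"

definition orthogonal_proj :: "'a::real_inner set \<Rightarrow> 'a \<Rightarrow> 'a" where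
  "orthogonal_proj M x = (THE y. y \<in> M \<and> (\<forall>z\<in>M. (x - y) \<bullet> z = 0))"

text \<open>
  The spectral theorem for a positive self-adjoint operator with compact inverse:
  with \<open>P\<^sub>\<mu>\<close> the orthogonal projection onto the eigenspace of \<open>\<mu>\<close>, one has
  \<open>A\<^sup>s x = \<Sum>\<^sub>\<mu> \<mu>\<^sup>s P\<^sub>\<mu> x\<close>, the domain consisting of the \<open>x\<close> with
  \<open>\<Sum>\<^sub>\<mu> \<mu>\<^sup>2\<^sup>s |P\<^sub>\<mu> x|\<^sup>2 < \<infinity>\<close>. The sums run over the distinct eigenvalues, all positive.
\<close>

definition frac_power_domain :: "'a::real_inner set \<Rightarrow> ('a \<Rightarrow> 'a) \<Rightarrow> real \<Rightarrow> 'a set" where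
  "frac_power_domain D A s =
     {x. (\<lambda>\<mu>. \<mu> powr (2 * s) * (norm (orthogonal_proj (eigenspace D A \<mu>) x))\<^sup>2)
           summable_on eigenvalues D A}"

definition frac_power :: "'a::real_inner set \<Rightarrow> ('a \<Rightarrow> 'a) \<Rightarrow> real \<Rightarrow> 'a \<Rightarrow> 'a" where
  "frac_power D A s x =
     (\<Sum>\<^sub>\<infinity>\<mu>\<in>eigenvalues D A. \<mu> powr s *\<^sub>R orthogonal_proj (eigenspace D A \<mu>) x)"

text \<open>The domain of the iterate \<open>A ^^ k\<close>.\<close>

primrec power_domain :: "'a set \<Rightarrow> ('a \<Rightarrow> 'a) \<Rightarrow> nat \<Rightarrow> 'a set" where
  "power_domain D A 0 = UNIV"
| "power_domain D A (Suc k) = {x \<in> D. A x \<in> power_domain D A k}"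

text \<open>
  Energy solutions of \<open>u'' + A u + c A\<^sup>\<alpha> u' = 0\<close> on \<open>[0,\<infinity>)\<close> with \<open>u(0) = u0\<close>, \<open>u'(0) = u1\<close>.
  Continuity into \<open>V = D(A\<^sup>1\<^sup>/\<^sup>2)\<close> is continuity for the graph norm of \<open>A\<^sup>1\<^sup>/\<^sup>2\<close>, which for coercive
  \<open>A\<close> is equivalent to \<open>|A\<^sup>1\<^sup>/\<^sup>2 v|\<close>. Derivatives at 0 are one-sided, and \<open>v\<close> is \<open>u'\<close>.
\<close>

definition energy_solution ::
  "'a::real_inner set \<Rightarrow> ('a \<Rightarrow> 'a) \<Rightarrow> real \<Rightarrow> real \<Rightarrow> 'a \<Rightarrow> 'a \<Rightarrow> (real \<Rightarrow> 'a) \<Rightarrow> bool" where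
  "energy_solution D A c \<alpha> u0 u1 u \<longleftrightarrow>
     (\<forall>t\<ge>0. u t \<in> frac_power_domain D A (1/2)) \<and>
     continuous_on {0..} u \<and>
     continuous_on {0..} (\<lambda>t. frac_power D A (1/2) (u t)) \<and>
     u 0 = u0 \<and>
     (\<exists>v. (\<forall>t\<ge>0. (u has_vector_derivative v t) (at t within {0..})) \<and>
          continuous_on {0..} v \<and>
          v 0 = u1 \<and>
          (\<forall>w\<in>D. \<exists>d. continuous_on {0..} d \<and>
             (\<forall>t\<ge>0. ((\<lambda>s. v s \<bullet> w) has_real_derivative d t) (at t within {0..}) \<and>
                     d t + u t \<bullet> A w + c * (v t \<bullet> frac_power D A \<alpha> w) = 0)))"

end

theory Submission
  imports Defs "HOL-Real_Asymp.Real_Asymp"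
begin

text \<open>
  On an eigenvector with eigenvalue \<open>\<mu>\<close> the equation is the scalar oscillator
  \<open>x'' + c \<mu>\<^sup>\<alpha> x' + \<mu> x = 0\<close>. Since \<open>\<alpha> < 1/2\<close>, it is underdamped for large \<open>\<mu>\<close>, with solutions
  \<open>exp (- \<sigma> t) cos (\<omega> t)\<close>, where \<open>\<sigma> = c \<mu>\<^sup>\<alpha> / 2\<close> and \<open>\<omega>\<^sup>2 = \<mu> - \<sigma>\<^sup>2\<close>. Only the factor
  \<open>exp (- c t \<mu>\<^sup>\<alpha> / 2)\<close> regularises, and it does not regularise more than that: a solution whose
  initial coordinates decay only polynomially in \<open>\<mu>\<close> has
  time averages of \<open>|A\<^sup>k u|\<^sup>2\<close> of the order of the supremum of \<open>\<mu>\<^sup>2\<^sup>k exp (- c t \<mu>\<^sup>\<alpha>)\<close> up to polynomial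
  factors. That supremum is attained at \<open>\<mu>\<^sup>\<alpha>\<close> proportional to \<open>k\<close>, and there the value is a constant to
  the power \<open>k\<close> times \<open>k\<close> to the power \<open>2 k / \<alpha>\<close>, which is the claim.

  For this the spectrum must meet every scale up to a bounded factor, which the ratio condition
  \<open>\<lambda>\<^sub>n\<^sub>+\<^sub>1 \<le> C \<lambda>\<^sub>n\<close> and the unboundedness of the eigenvalues provide. One may even thin the spectrum
  out to a sequence \<open>\<mu>\<close> with \<open>C \<mu> j \<le> \<mu> (Suc j) \<le> C\<^sup>2 \<mu> j\<close>, lying above the threshold for
  underdamping (\<open>lacunary_sequence_exists\<close>), and choose one unit eigenvector \<open>e j\<close> for each member. The
  solution is the sum of \<open>(\<mu> j)\<^sup>-\<^sup>2 exp (- \<sigma> j t) cos (\<omega> j t) e j\<close>. As \<open>\<mu>\<close> grows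
  geometrically, the series for \<open>u\<close>, \<open>u'\<close> and \<open>u''\<close> are dominated by multiples of \<open>1 / \<mu> j\<close>, so they
  converge absolutely and may be differentiated termwise (\<open>energy_solution_modes\<close>), and for \<open>t > 0\<close> the powers of \<open>A\<close>
  act termwise (\<open>operator_power_modes\<close>).

  Two points need functional analysis. That \<open>A\<close> acts termwise follows from \<open>A\<^sup>* = A\<close>
  (\<open>operator_eigen_series\<close>). The weak form of the equation contains \<open>A\<^sup>\<alpha> w\<close> for an arbitrary \<open>w\<close> in the domain,
  a series over the whole spectrum that need not converge absolutely; its convergence comes from
  orthogonality and Bessel's inequality (\<open>frac_power_summable\<close>).

  The lower bound keeps a single mode (\<open>integral_ge_single_mode\<close>), chosen with \<open>(\<mu> j)\<^sup>\<alpha>\<close>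
  proportional to \<open>k\<close> (\<open>mode_lower_bound\<close>, \<open>integral_operator_power_lower_bound\<close>).
\<close>

section \<open>Orthogonal projections and orthogonal series\<close>

lemma orthogonal_proj_eqI:
  assumes "subspace M" "y \<in> M" "\<And>z. z \<in> M \<Longrightarrow> (x - y) \<bullet> z = 0"
  shows "orthogonal_proj M x = y"
  unfolding orthogonal_proj_def
proof (rule the_equality)
  show "y \<in> M \<and> (\<forall>z\<in>M. (x - y) \<bullet> z = 0)"
    using assms by blast
  fix y' assume y': "y' \<in> M \<and> (\<forall>z\<in>M. (x - y') \<bullet> z = 0)"
  have d: "y - y' \<in> M"
    using assms(1,2) y' by (simp add: subspace_diff)
  have "(y - y') \<bullet> (y - y') = (x - y') \<bullet> (y - y') - (x - y) \<bullet> (y - y')"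
    by (simp add: inner_diff_left)
  also have "\<dots> = 0"
    using d y' assms(3) by simp
  finally show "y' = y"
    by simp
qed

text \<open>
  For a finite spanning set the projection is explicit: orthogonalise the set and add up the
  components along its members.
\<close>

lemma orthogonal_proj_span_finite:
  fixes B :: "'a::real_inner set"
  assumes "finite B"
  shows "orthogonal_proj (span B) x \<in> span B"
    and "z \<in> span B \<Longrightarrow> (x - orthogonal_proj (span B) x) \<bullet> z = 0"
proof -
  obtain C where C: "finite C" "span C = span B" "pairwise orthogonal C"
    using basis_orthogonal[OF assms] by blast
  define y where "y = (\<Sum>b\<in>C. (b \<bullet> x / (b \<bullet> b)) *\<^sub>R b)"
  have y: "y \<in> span B"
    unfolding y_def C(2)[symmetric] by (intro span_sum span_mul span_base)
  have "(x - y) \<bullet> b = 0" if "b \<in> C" for b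
  proof -
    have "y \<bullet> b = (\<Sum>b'\<in>C. if b' = b then b \<bullet> x else 0)"
      unfolding y_def inner_sum_left
      using C(3) that by (intro sum.cong) (auto simp: pairwise_def orthogonal_def)
    also have "\<dots> = b \<bullet> x"
      using C(1) that by simp
    finally show ?thesis
      by (simp add: inner_diff_left inner_commute[of x b])
  qed
  then have "\<forall>b\<in>C. orthogonal (x - y) b"
    by (simp add: orthogonal_def)
  then have orth: "(x - y) \<bullet> z = 0" if "z \<in> span B" for z
    using that orthogonal_to_span[of z C "x - y"] C(2) by (auto simp: orthogonal_def)
  then have "orthogonal_proj (span B) x = y"
    using y by (intro orthogonal_proj_eqI) auto
  then show "orthogonal_proj (span B) x \<in> span B"
    and "z \<in> span B \<Longrightarrow> (x - orthogonal_proj (span B) x) \<bullet> z = 0"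
    using y orth by auto
qed

text \<open>
  By Pythagoras, the squared distance between a finite partial sum and a smaller one is the
  difference of the sums of squared norms. Bounded sums of squares therefore make the net of
  finite partial sums Cauchy, although the series need not converge absolutely.
\<close>

lemma orthogonal_summable_on:
  fixes f :: "'i \<Rightarrow> 'a::{real_inner, banach}"
  assumes orth: "pairwise (\<lambda>i j. orthogonal (f i) (f j)) I"
    and bound: "\<And>F. finite F \<Longrightarrow> F \<subseteq> I \<Longrightarrow> (\<Sum>i\<in>F. (norm (f i))\<^sup>2) \<le> K"
  shows "f summable_on I"
proof -
  define s where "s F = (\<Sum>i\<in>F. (norm (f i))\<^sup>2)" for F
  define Fs where "Fs = {F. finite F \<and> F \<subseteq> I}"
  have bdd: "bdd_above (s ` Fs)"
    using bound by (auto simp: s_def Fs_def intro!: bdd_aboveI2)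
  have ne: "s ` Fs \<noteq> {}"
    by (auto simp: Fs_def)
  have "\<exists>P. eventually P (finite_subsets_at_top I) \<and>
          (\<forall>F F'. P F \<and> P F' \<longrightarrow> dist (sum f F) (sum f F') < \<epsilon>)" if "\<epsilon> > 0" for \<epsilon>
  proof -
    have "\<exists>y\<in>s ` Fs. Sup (s ` Fs) - (\<epsilon>/2)\<^sup>2 < y"
      using that by (intro less_cSup_iff[OF ne bdd, THEN iffD1]) simp
    then obtain F0 where F0: "F0 \<in> Fs" "Sup (s ` Fs) - (\<epsilon>/2)\<^sup>2 < s F0"
      by blast
    \<comment> \<open>Beyond \<open>F0\<close> less than \<open>(\<epsilon>/2)\<^sup>2\<close> of the sum of squares is left.\<close>
    define P where "P F \<longleftrightarrow> F \<in> Fs \<and> F0 \<subseteq> F" for F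
    have ev: "eventually P (finite_subsets_at_top I)"
      unfolding eventually_finite_subsets_at_top using F0(1) by (auto simp: P_def Fs_def)
    have close: "dist (sum f F) (sum f F0) < \<epsilon>/2" if "P F" for F
    proof -
      have F: "finite F" "F0 \<subseteq> F" "F \<subseteq> I" "F \<in> Fs"
        using that by (auto simp: P_def Fs_def)
      have "(dist (sum f F) (sum f F0))\<^sup>2 = (norm (sum f (F - F0)))\<^sup>2"
        using F by (simp add: dist_norm sum_diff)
      also have "\<dots> = s (F - F0)"
        unfolding s_def using F by (intro norm_sum_Pythagorean pairwise_subset[OF orth]) auto
      also have "\<dots> = s F - s F0"
        unfolding s_def using F by (simp add: sum_diff)
      also have "\<dots> < (\<epsilon>/2)\<^sup>2"
        using cSup_upper[OF imageI[OF F(4)] bdd] F0(2) by linarith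
      finally show ?thesis
        by (rule power_less_imp_less_base) (use \<open>\<epsilon> > 0\<close> in simp)
    qed
    have "dist (sum f F) (sum f F') < \<epsilon>" if "P F" "P F'" for F F'
      using close[OF that(1)] close[OF that(2)] dist_triangle2[of "sum f F" "sum f F'" "sum f F0"]
      by linarith
    with ev show ?thesis
      by blast
  qed
  then have "cauchy_filter (filtermap (sum f) (finite_subsets_at_top I))"
    by (simp add: cauchy_filter_metric_filtermap)
  moreover have "complete (UNIV::'a set)"
    by (meson Cauchy_convergent UNIV_I complete_def convergent_def)
  ultimately obtain L where "(sum f \<longlongrightarrow> L) (finite_subsets_at_top I)"
    using complete_uniform[where S=UNIV] by (force simp add: filterlim_def)
  then show ?thesis
    using summable_on_def has_sum_def by blast
qed

section \<open>Dominated series of vector-valued functions\<close>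

lemma has_vector_derivative_suminf:
  fixes f :: "nat \<Rightarrow> real \<Rightarrow> 'a::banach"
  assumes "convex X"
    and der: "\<And>n x. x \<in> X \<Longrightarrow> (f n has_vector_derivative f' n x) (at x within X)"
    and bound: "\<And>n x. x \<in> X \<Longrightarrow> norm (f' n x) \<le> M n" and "summable M"
    and "\<And>x. x \<in> X \<Longrightarrow> summable (\<lambda>n. f n x)" and x: "x \<in> X"
  shows "((\<lambda>x. \<Sum>n. f n x) has_vector_derivative (\<Sum>n. f' n x)) (at x within X)"
proof -
  have lim: "uniform_limit X (\<lambda>n x. \<Sum>i<n. f' i x) (\<lambda>x. \<Sum>i. f' i x) sequentially"
    using bound \<open>summable M\<close> by (rule Weierstrass_m_test)
  have "\<exists>g. \<forall>x\<in>X. (\<lambda>n. f n x) sums g x \<and>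
          (g has_derivative (\<lambda>h. h *\<^sub>R (\<Sum>i. f' i x))) (at x within X)"
  proof (rule has_derivative_series[where f' = "\<lambda>n x h. h *\<^sub>R f' n x", OF \<open>convex X\<close> _ _ x])
    show "(f n has_derivative (\<lambda>h. h *\<^sub>R f' n y)) (at y within X)" if "y \<in> X" for n y
      using der[OF that] by (simp add: has_vector_derivative_def)
    show "\<forall>\<^sub>F n in sequentially. \<forall>x\<in>X. \<forall>h. norm ((\<Sum>i<n. h *\<^sub>R f' i x) - h *\<^sub>R (\<Sum>i. f' i x))
            \<le> e * norm h" if "e > 0" for e
      using uniform_limitD[OF lim that]
    proof eventually_elim
      case (elim n)
      have "norm ((\<Sum>i<n. h *\<^sub>R f' i x) - h *\<^sub>R (\<Sum>i. f' i x)) \<le> e * norm h" if "x \<in> X" for x h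
      proof -
        have "norm ((\<Sum>i<n. h *\<^sub>R f' i x) - h *\<^sub>R (\<Sum>i. f' i x))
            = norm h * dist (\<Sum>i<n. f' i x) (\<Sum>i. f' i x)"
          by (simp add: dist_norm scaleR_sum_right[symmetric] scaleR_diff_right[symmetric])
        also have "\<dots> \<le> norm h * e"
          using elim that by (intro mult_left_mono) (auto intro: less_imp_le)
        finally show ?thesis
          by (simp add: mult.commute)
      qed
      then show ?case
        by blast
    qed
    show "(\<lambda>n. f n x) sums (\<Sum>n. f n x)"
      using assms(5) x by (simp add: summable_sums)
  qed
  then obtain g where g: "\<And>y. y \<in> X \<Longrightarrow> (\<lambda>n. f n y) sums g y"
      "\<And>y. y \<in> X \<Longrightarrow> (g has_derivative (\<lambda>h. h *\<^sub>R (\<Sum>i. f' i y))) (at y within X)"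
    by blast
  have "(\<Sum>n. f n y) = g y" if "y \<in> X" for y
    using g(1)[OF that] by (simp add: sums_iff)
  then show ?thesis
    using g(2)[OF x] x unfolding has_vector_derivative_def
    by (rule_tac has_derivative_transform[where f = g]) auto
qed

lemma continuous_on_suminf_M_test:
  fixes f :: "nat \<Rightarrow> 'b::topological_space \<Rightarrow> 'a::banach"
  assumes "\<And>n. continuous_on X (f n)"
    and "\<And>n x. x \<in> X \<Longrightarrow> norm (f n x) \<le> M n" and "summable M"
  shows "continuous_on X (\<lambda>x. \<Sum>n. f n x)"
  using Weierstrass_m_test[OF assms(2,3)]
  by (rule uniform_limit_theorem[rotated])
    (auto intro!: always_eventually continuous_on_sum assms(1))

section \<open>Real estimates\<close>

lemma power_times_exp_powr_bounded:
  fixes \<alpha> s :: real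
  assumes "0 < \<alpha>" "0 < s"
  shows "\<exists>K. \<forall>x\<ge>1. x ^ k * exp (- (s * x powr \<alpha>)) \<le> K"
proof -
  have "((\<lambda>x. x ^ k * exp (- (s * x powr \<alpha>))) \<longlongrightarrow> 0) at_top"
    using assms by real_asymp
  then have "eventually (\<lambda>x. x ^ k * exp (- (s * x powr \<alpha>)) < 1) at_top"
    by (rule order_tendstoD) simp
  then obtain N where N: "\<And>x. x \<ge> N \<Longrightarrow> x ^ k * exp (- (s * x powr \<alpha>)) < 1"
    by (auto simp: eventually_at_top_linorder)
  have "x ^ k * exp (- (s * x powr \<alpha>)) \<le> max 1 (N ^ k)" if "x \<ge> 1" for x
  proof (cases "x \<ge> N")
    case True
    then show ?thesis
      using N[of x] by simp
  next
    case False
    have "x ^ k * exp (- (s * x powr \<alpha>)) \<le> x ^ k * 1"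
      using assms that by (intro mult_left_mono) auto
    also have "\<dots> \<le> N ^ k"
      using False that by (auto intro: power_mono)
    finally show ?thesis
      by simp
  qed
  then show ?thesis
    by blast
qed

lemma powr_le_sqrt_eventually:
  fixes \<alpha> c :: real
  assumes "\<alpha> < 1/2"
  shows "eventually (\<lambda>x. c * x powr \<alpha> \<le> sqrt x) at_top"
  using assms by real_asymp

text \<open>
  The first term that is at least \<open>x\<close> overshoots \<open>x\<close> by at most the factor \<open>C\<close>, because its
  predecessor is below \<open>x\<close>.
\<close>

lemma exists_term_within_ratio:
  fixes ev :: "nat \<Rightarrow> real"
  assumes ratio: "\<And>n. n \<ge> m \<Longrightarrow> ev (Suc n) \<le> C * ev n" and "C \<ge> 1"
    and unbounded: "\<And>y. \<exists>n\<ge>m. ev n \<ge> y" and x: "ev m \<le> x" "x > 0"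
  shows "\<exists>n\<ge>m. x \<le> ev n \<and> ev n \<le> C * x"
proof -
  define n where "n = (LEAST n. n \<ge> m \<and> ev n \<ge> x)"
  have n: "n \<ge> m" "ev n \<ge> x"
    using LeastI_ex[of "\<lambda>n. n \<ge> m \<and> ev n \<ge> x"] unbounded unfolding n_def by auto
  have xC: "x \<le> C * x"
    using \<open>C \<ge> 1\<close> x by simp
  have "ev n \<le> C * x"
  proof (cases "n = m")
    case True
    then show ?thesis
      unfolding True using x(1) xC by linarith
  next
    case False
    then obtain i where i: "n = Suc i" "i \<ge> m"
      using n(1) by (cases n) auto
    have "\<not> (i \<ge> m \<and> ev i \<ge> x)"
      using not_less_Least[of i "\<lambda>n. n \<ge> m \<and> ev n \<ge> x"] i(1) unfolding n_def by simp
    then have "ev i \<le> x"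
      using i(2) by simp
    then have "C * ev i \<le> C * x"
      using \<open>C \<ge> 1\<close> by simp
    then show ?thesis
      using ratio[OF i(2)] i(1) by simp
  qed
  then show ?thesis
    using n by blast
qed

text \<open>
  The mean of \<open>cos\<^sup>2\<close> is \<open>1/2\<close> and the oscillating part of its integral is at most \<open>1 / (2 * \<omega>)\<close>,
  which costs no more than half of the main term once the interval is at least \<open>2 / \<omega>\<close> long.
\<close>

lemma integral_cos_squared_ge:
  fixes \<omega> t \<theta> :: real
  assumes "t < \<theta>" "\<omega> * (\<theta> - t) \<ge> 2"
  shows "(\<theta> - t) / 4 \<le> integral {t..\<theta>} (\<lambda>s. (cos (\<omega> * s))\<^sup>2)"
proof -
  have \<omega>: "\<omega> > 0"
    using assms by (smt (verit) mult_nonpos_nonneg)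
  define F where "F s = s / 2 + sin (2 * \<omega> * s) / (4 * \<omega>)" for s
  have "((\<lambda>s. (cos (\<omega> * s))\<^sup>2) has_integral F \<theta> - F t) {t..\<theta>}"
  proof (rule fundamental_theorem_of_calculus)
    fix s assume "s \<in> {t..\<theta>}"
    have "(F has_real_derivative (1 + cos (2 * \<omega> * s)) / 2) (at s within {t..\<theta>})"
      unfolding F_def using \<omega> by (auto intro!: derivative_eq_intros simp: field_simps)
    moreover have "(1 + cos (2 * \<omega> * s)) / 2 = (cos (\<omega> * s))\<^sup>2"
      using cos_double_cos[of "\<omega> * s"] by (simp add: mult.assoc)
    ultimately show "(F has_vector_derivative (cos (\<omega> * s))\<^sup>2) (at s within {t..\<theta>})"
      by (simp add: has_real_derivative_iff_has_vector_derivative)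
  qed (use assms in simp)
  then have "integral {t..\<theta>} (\<lambda>s. (cos (\<omega> * s))\<^sup>2) = F \<theta> - F t"
    by (rule integral_unique)
  also have "F \<theta> - F t = (\<theta> - t) / 2 + (sin (2 * \<omega> * \<theta>) - sin (2 * \<omega> * t)) / (4 * \<omega>)"
    by (simp add: F_def diff_divide_distrib)
  also have "\<dots> \<ge> (\<theta> - t) / 2 + (- 2) / (4 * \<omega>)"
    using \<omega> sin_le_one[of "2 * \<omega> * t"] sin_ge_minus_one[of "2 * \<omega> * \<theta>"]
    by (intro add_left_mono divide_right_mono) linarith+
  also have "(\<theta> - t) / 2 + (- 2) / (4 * \<omega>) \<ge> (\<theta> - t) / 4"
    using assms \<omega> by (simp add: field_simps)
  finally show ?thesis .
qed

text \<open>
  With \<open>m\<^sup>\<alpha>\<close> comparable to \<open>k\<close>, the factor \<open>m\<^sup>2\<^sup>k\<close> is at least \<open>k\<close> to the power \<open>2 k / \<alpha>\<close>, while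
  all remaining factors lose at most a constant to the power \<open>k\<close>: the damping because
  \<open>m\<^sup>\<alpha> \<le> (C M)\<^sup>\<alpha> k\<close>, the weight because \<open>m\<^sup>4 \<le> exp (4 m\<^sup>\<alpha> / \<alpha>)\<close> (from \<open>ln y \<le> y\<close> at \<open>y = m\<^sup>\<alpha>\<close>), and \<open>d\<close>
  because \<open>min 1 d ^ k \<le> d\<close>. The power \<open>\<alpha>/2\<close> in \<open>\<delta>\<close> turns such a constant into part of the base on the
  left-hand side.
\<close>

lemma mode_lower_bound:
  fixes \<alpha> m M d T C :: real and k :: nat
  assumes \<alpha>: "\<alpha> > 0" and k: "k \<ge> 1" and M: "M \<ge> 1" and T: "T \<ge> 0" and d: "d > 0"
    and lower: "M * real k powr (1/\<alpha>) \<le> m" and upper: "m \<le> C * (M * real k powr (1/\<alpha>))"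
  defines "\<delta> \<equiv> (exp (- (T + 4/\<alpha>) * (C * M) powr \<alpha>) * min 1 d) powr (\<alpha>/2)"
  shows "(\<delta> * real k) powr (2 * real k / \<alpha>) \<le> m ^ (2 * k) / m ^ 4 * exp (- T * m powr \<alpha>) * d"
proof -
  define L where "L = (C * M) powr \<alpha>"
  define q where "q = exp (- (T + 4/\<alpha>) * L) * min 1 d"
  have \<delta>_eq: "\<delta> = q powr (\<alpha>/2)"
    unfolding \<delta>_def q_def L_def ..
  have q: "q > 0"
    using d by (simp add: q_def)
  have r: "real k powr (1/\<alpha>) \<ge> 1"
    using k \<alpha> by (intro ge_one_powr_ge_zero) auto
  have km: "real k powr (1/\<alpha>) \<le> m"
    using lower mult_right_mono[OF M, of "real k powr (1/\<alpha>)"] r by simp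
  then have m: "m \<ge> 1"
    using r by simp
  have CM: "C * M \<ge> 0"
    using upper m r by (smt (verit) mult.assoc mult_neg_pos)
  have "m powr \<alpha> \<le> (C * M * real k powr (1/\<alpha>)) powr \<alpha>"
    using upper m \<alpha> by (intro powr_mono2) (auto simp: mult.assoc)
  also have "\<dots> = L * real k"
    using CM \<alpha> k by (simp add: L_def powr_mult powr_powr)
  finally have mL: "m powr \<alpha> \<le> L * real k" .

  have "ln m = ln (m powr \<alpha>) / \<alpha>"
    using \<alpha> m by (simp add: ln_powr)
  also have "\<dots> \<le> m powr \<alpha> / \<alpha>"
    using \<alpha> m ln_bound[of "m powr \<alpha>"] by (intro divide_right_mono) auto
  finally have "exp (4 * ln m) \<le> exp (4/\<alpha> * m powr \<alpha>)"
    by simp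
  also have "exp (4 * ln m) = m ^ 4"
    using m exp_of_nat_mult[of 4 "ln m"] by simp
  finally have m4: "m ^ 4 \<le> exp (4/\<alpha> * m powr \<alpha>)" .

  have "exp (- (T + 4/\<alpha>) * L) ^ k = exp (- (T + 4/\<alpha>) * (L * real k))"
    by (simp add: exp_of_nat_mult[symmetric] mult_ac)
  also have "\<dots> \<le> exp (- (T + 4/\<alpha>) * m powr \<alpha>)"
  proof -
    have "(T + 4/\<alpha>) * m powr \<alpha> \<le> (T + 4/\<alpha>) * (L * real k)"
      using mL T \<alpha> by (intro mult_left_mono) auto
    then show ?thesis
      by (simp only: exp_le_cancel_iff mult_minus_left neg_le_iff_le)
  qed
  also have "\<dots> = exp (- T * m powr \<alpha>) / exp (4/\<alpha> * m powr \<alpha>)"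
    by (simp add: exp_diff[symmetric] algebra_simps)
  also have "\<dots> \<le> exp (- T * m powr \<alpha>) / m ^ 4"
    using m4 m by (intro divide_left_mono) auto
  finally have exp_le: "exp (- (T + 4/\<alpha>) * L) ^ k \<le> exp (- T * m powr \<alpha>) / m ^ 4" .
  have min_le: "min 1 d ^ k \<le> d"
  proof -
    have "min 1 d ^ k \<le> min 1 d ^ 1"
      using k d by (intro power_decreasing) auto
    then show ?thesis
      by simp
  qed
  have "q powr real k = exp (- (T + 4/\<alpha>) * L) ^ k * min 1 d ^ k"
    using q by (simp add: powr_realpow) (simp add: q_def power_mult_distrib)
  also have "\<dots> \<le> exp (- T * m powr \<alpha>) / m ^ 4 * d"
    using exp_le min_le m d by (intro mult_mono) auto
  finally have q_le: "q powr real k \<le> exp (- T * m powr \<alpha>) / m ^ 4 * d" .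

  have "real k powr (2 * real k / \<alpha>) = (real k powr (1/\<alpha>)) powr real (2 * k)"
    by (simp add: powr_powr)
  also have "\<dots> \<le> m powr real (2 * k)"
    using km by (intro powr_mono2) auto
  also have "\<dots> = m ^ (2 * k)"
    using m by (intro powr_realpow) auto
  finally have k_le: "real k powr (2 * real k / \<alpha>) \<le> m ^ (2 * k)" .

  have "(\<delta> * real k) powr (2 * real k / \<alpha>)
      = (q powr (\<alpha>/2)) powr (2 * real k / \<alpha>) * real k powr (2 * real k / \<alpha>)"
    by (simp add: \<delta>_eq powr_mult)
  also have "(q powr (\<alpha>/2)) powr (2 * real k / \<alpha>) = q powr real k"
    using \<alpha> by (simp add: powr_powr)
  also have "q powr real k * real k powr (2 * real k / \<alpha>)
      \<le> (exp (- T * m powr \<alpha>) / m ^ 4 * d) * m ^ (2 * k)"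
    using q_le k_le m d by (intro mult_mono) auto
  finally show ?thesis
    by (simp add: mult_ac)
qed

section \<open>Self-adjoint operators and their eigenspaces\<close>

lemma self_adjoint_symmetric:
  assumes "self_adjoint D A" "x \<in> D" "y \<in> D"
  shows "A x \<bullet> y = x \<bullet> A y"
  using assms by (simp add: self_adjoint_def)

text \<open>
  \<open>A\<^sup>* = A\<close> with a dense domain: testing against the domain decides both whether a vector lies in
  the domain and what its image is.
\<close>

lemma self_adjoint_graphI:
  assumes sa: "self_adjoint D A" and eq: "\<And>x. x \<in> D \<Longrightarrow> A x \<bullet> y = x \<bullet> z"
  shows "y \<in> D" "A y = z"
proof -
  have "y \<in> adjoint_domain D A"
    using eq by (auto simp: adjoint_domain_def)
  then show y: "y \<in> D"
    using sa by (simp add: self_adjoint_def)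
  have "D \<subseteq> {x. x \<bullet> (A y - z) = 0}"
    using eq self_adjoint_symmetric[OF sa _ y] by (auto simp: inner_diff_right)
  moreover have "closed {x. x \<bullet> (A y - z) = 0}"
    by (intro closed_Collect_eq continuous_intros)
  ultimately have "closure D \<subseteq> {x. x \<bullet> (A y - z) = 0}"
    by (rule closure_minimal)
  moreover have "closure D = UNIV"
    using sa by (simp add: self_adjoint_def densely_defined_operator_def)
  ultimately have "(A y - z) \<bullet> (A y - z) = 0"
    by blast
  then show "A y = z"
    by simp
qed

lemma subspace_eigenspace:
  assumes "self_adjoint D A"
  shows "subspace (eigenspace D A \<nu>)"
proof -
  have lin: "subspace D" "\<And>x y. x \<in> D \<Longrightarrow> y \<in> D \<Longrightarrow> A (x + y) = A x + A y"
      "\<And>r x. x \<in> D \<Longrightarrow> A (r *\<^sub>R x) = r *\<^sub>R A x"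
    using assms by (auto simp: self_adjoint_def densely_defined_operator_def)
  have "A 0 = 0"
    using lin(3)[of 0 0] subspace_0[OF lin(1)] by simp
  then show ?thesis
    unfolding subspace_def eigenspace_def using lin
    by (auto simp: subspace_def scaleR_add_right)
qed

lemma eigenspaces_orthogonal:
  assumes "self_adjoint D A" "x \<in> eigenspace D A \<mu>" "y \<in> eigenspace D A \<nu>" "\<mu> \<noteq> \<nu>"
  shows "x \<bullet> y = 0"
  using self_adjoint_symmetric[OF assms(1), of x y] assms(2-4)
  by (auto simp: eigenspace_def)

lemma coercive_eigenvalues_bounded_below:
  assumes "coercive D A"
  obtains a where "a > 0" "\<And>\<nu>. \<nu> \<in> eigenvalues D A \<Longrightarrow> a \<le> \<nu>"
proof -
  obtain a where a: "a > 0" "\<And>w. w \<in> D \<Longrightarrow> A w \<bullet> w \<ge> a * (norm w)\<^sup>2"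
    using assms by (auto simp: coercive_def)
  have "a \<le> \<nu>" if \<nu>: "\<nu> \<in> eigenvalues D A" for \<nu>
  proof -
    obtain x where x: "x \<in> D" "A x = \<nu> *\<^sub>R x" "x \<noteq> 0"
      using \<nu> by (auto simp: eigenvalues_def eigenspace_def)
    then have "a * (norm x)\<^sup>2 \<le> \<nu> * (norm x)\<^sup>2"
      using a(2)[OF x(1)] by (simp add: power2_norm_eq_inner)
    then show ?thesis
      using x(3) by simp
  qed
  with a(1) show ?thesis
    using that by blast
qed

section \<open>Fractional powers\<close>

text \<open>
  Finite-dimensional eigenspaces ensure that the orthogonal projections onto them exist.
\<close>

locale finite_multiplicity_operator =
  fixes D :: "'a::{real_inner, banach} set" and A :: "'a \<Rightarrow> 'a"
  assumes sa: "self_adjoint D A"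
    and coer: "coercive D A"
    and fin_mult: "\<And>\<nu>. \<exists>B. finite B \<and> span B = eigenspace D A \<nu>"
begin

abbreviation P :: "real \<Rightarrow> 'a \<Rightarrow> 'a" where
  "P \<nu> \<equiv> orthogonal_proj (eigenspace D A \<nu>)"

lemma P_in: "P \<nu> x \<in> eigenspace D A \<nu>"
  and P_orth: "z \<in> eigenspace D A \<nu> \<Longrightarrow> (x - P \<nu> x) \<bullet> z = 0"
proof -
  obtain B where "finite B" "span B = eigenspace D A \<nu>"
    using fin_mult by blast
  then show "P \<nu> x \<in> eigenspace D A \<nu>"
    and "z \<in> eigenspace D A \<nu> \<Longrightarrow> (x - P \<nu> x) \<bullet> z = 0"
    using orthogonal_proj_span_finite[of B] by metis+
qed

lemma P_eqI:
  assumes "y \<in> eigenspace D A \<nu>" "\<And>z. z \<in> eigenspace D A \<nu> \<Longrightarrow> x \<bullet> z = y \<bullet> z"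
  shows "P \<nu> x = y"
  using assms by (intro orthogonal_proj_eqI subspace_eigenspace sa) (auto simp: inner_diff_left)

lemma bessel:
  assumes "finite F"
  shows "(\<Sum>\<nu>\<in>F. (norm (P \<nu> x))\<^sup>2) \<le> (norm x)\<^sup>2"
proof -
  define p where "p = (\<Sum>\<nu>\<in>F. P \<nu> x)"
  have "x \<bullet> P \<nu> x = (norm (P \<nu> x))\<^sup>2" for \<nu>
    using P_orth[OF P_in, of x \<nu> x] by (simp add: inner_diff_left power2_norm_eq_inner)
  then have xp: "x \<bullet> p = (\<Sum>\<nu>\<in>F. (norm (P \<nu> x))\<^sup>2)"
    by (simp add: p_def inner_sum_right)
  have "(norm p)\<^sup>2 = (\<Sum>\<nu>\<in>F. (norm (P \<nu> x))\<^sup>2)"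
    unfolding p_def using assms eigenspaces_orthogonal[OF sa P_in P_in]
    by (intro norm_sum_Pythagorean) (auto simp: pairwise_def orthogonal_def)
  moreover have "(norm (x - p))\<^sup>2 = (norm x)\<^sup>2 - 2 * (x \<bullet> p) + (norm p)\<^sup>2"
    by (simp add: power2_norm_eq_inner inner_diff_left inner_diff_right inner_commute)
  ultimately show ?thesis
    using xp zero_le_power2[of "norm (x - p)"] by linarith
qed

lemma P_operator:
  assumes "w \<in> D"
  shows "P \<nu> (A w) = \<nu> *\<^sub>R P \<nu> w"
proof (rule P_eqI)
  show "\<nu> *\<^sub>R P \<nu> w \<in> eigenspace D A \<nu>"
    using P_in subspace_eigenspace[OF sa] by (simp add: subspace_scale)
  fix z assume z: "z \<in> eigenspace D A \<nu>"
  then have "A w \<bullet> z = \<nu> * (w \<bullet> z)"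
    using self_adjoint_symmetric[OF sa assms, of z] by (simp add: eigenspace_def)
  then show "A w \<bullet> z = (\<nu> *\<^sub>R P \<nu> w) \<bullet> z"
    using P_orth[OF z, of w] by (simp add: inner_diff_left)
qed

text \<open>
  On the domain of \<open>A\<close> the series that defines \<open>A\<^sup>s\<close> converges for \<open>s \<le> 1\<close>: as the spectrum is bounded
  away from 0, \<open>\<nu>\<^sup>s\<close> is at most a constant times \<open>\<nu>\<close>, and \<open>\<nu> P\<^sub>\<nu> w = P\<^sub>\<nu> (A w)\<close> is square summable
  by Bessel's inequality.
\<close>

lemma frac_power_summable:
  assumes "w \<in> D" "s \<le> 1"
  shows "(\<lambda>\<nu>. \<nu> powr s *\<^sub>R P \<nu> w) summable_on eigenvalues D A"
proof -
  obtain a where a: "a > 0" "\<And>\<nu>. \<nu> \<in> eigenvalues D A \<Longrightarrow> a \<le> \<nu>"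
    using coercive_eigenvalues_bounded_below[OF coer] by blast
  define K where "K = a powr (s - 1)"
  have powr_le: "\<nu> powr s \<le> K * \<nu>" if "\<nu> \<in> eigenvalues D A" for \<nu>
  proof -
    have \<nu>: "\<nu> > 0" "a \<le> \<nu>"
      using a that by force+
    have "\<nu> powr s = \<nu> powr (s - 1) * \<nu> powr 1"
      unfolding powr_add[symmetric] by simp
    also have "\<dots> \<le> K * \<nu> powr 1"
      unfolding K_def using assms a(1) \<nu> by (intro mult_right_mono powr_mono2') auto
    finally show ?thesis
      using \<nu> by simp
  qed
  show ?thesis
  proof (rule orthogonal_summable_on[where K = "K\<^sup>2 * (norm (A w))\<^sup>2"])
    show "pairwise (\<lambda>\<nu> \<nu>'. orthogonal (\<nu> powr s *\<^sub>R P \<nu> w) (\<nu>' powr s *\<^sub>R P \<nu>' w)) (eigenvalues D A)"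
      using eigenspaces_orthogonal[OF sa P_in P_in] by (auto simp: pairwise_def orthogonal_def)
    fix F assume F: "finite F" "F \<subseteq> eigenvalues D A"
    have "(\<Sum>\<nu>\<in>F. (norm (\<nu> powr s *\<^sub>R P \<nu> w))\<^sup>2) \<le> (\<Sum>\<nu>\<in>F. K\<^sup>2 * (norm (P \<nu> (A w)))\<^sup>2)"
    proof (rule sum_mono)
      fix \<nu> assume "\<nu> \<in> F"
      then have \<nu>: "\<nu> powr s \<le> K * \<nu>"
        using F powr_le by blast
      have "(norm (\<nu> powr s *\<^sub>R P \<nu> w))\<^sup>2 = (\<nu> powr s)\<^sup>2 * (norm (P \<nu> w))\<^sup>2"
        by (simp add: power_mult_distrib)
      also have "\<dots> \<le> (K * \<nu>)\<^sup>2 * (norm (P \<nu> w))\<^sup>2"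
        using \<nu> by (intro mult_right_mono power_mono) auto
      also have "\<dots> = K\<^sup>2 * (norm (P \<nu> (A w)))\<^sup>2"
        using assms(1) by (simp add: P_operator power_mult_distrib)
      finally show "(norm (\<nu> powr s *\<^sub>R P \<nu> w))\<^sup>2 \<le> K\<^sup>2 * (norm (P \<nu> (A w)))\<^sup>2" .
    qed
    also have "\<dots> \<le> K\<^sup>2 * (norm (A w))\<^sup>2"
      using bessel[OF F(1), of "A w"] by (simp add: sum_distrib_left[symmetric] mult_left_mono)
    finally show "(\<Sum>\<nu>\<in>F. (norm (\<nu> powr s *\<^sub>R P \<nu> w))\<^sup>2) \<le> K\<^sup>2 * (norm (A w))\<^sup>2" .
  qed
qed

text \<open>
  Testing \<open>A\<^sup>s w\<close> against an eigenvector picks out one term of the defining series. The convergence of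
  that series is essential here, since a divergent one has the default value 0.
\<close>

lemma inner_frac_power:
  assumes "w \<in> D" "s \<le> 1" and x: "x \<in> eigenspace D A \<mu>"
  shows "x \<bullet> frac_power D A s w = \<mu> powr s * (x \<bullet> w)"
proof (cases "x = 0")
  case False
  then have \<mu>: "\<mu> \<in> eigenvalues D A"
    using x by (auto simp: eigenvalues_def)
  have "((\<lambda>\<nu>. \<nu> powr s *\<^sub>R P \<nu> w) has_sum frac_power D A s w) (eigenvalues D A)"
    using frac_power_summable[OF assms(1,2)] unfolding frac_power_def by (rule has_sum_infsum)
  then have "((\<lambda>\<nu>. x \<bullet> (\<nu> powr s *\<^sub>R P \<nu> w)) has_sum (x \<bullet> frac_power D A s w)) (eigenvalues D A)"
    by (rule has_sum_bounded_linear[OF bounded_linear_inner_right])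
  \<comment> \<open>All terms with \<open>\<nu> \<noteq> \<mu>\<close> vanish, as distinct eigenspaces are orthogonal.\<close>
  moreover have "((\<lambda>\<nu>. x \<bullet> (\<nu> powr s *\<^sub>R P \<nu> w)) has_sum (x \<bullet> (\<mu> powr s *\<^sub>R P \<mu> w))) {\<mu>}"
    by (rule has_sum_finiteI) auto
  then have "((\<lambda>\<nu>. x \<bullet> (\<nu> powr s *\<^sub>R P \<nu> w)) has_sum (x \<bullet> (\<mu> powr s *\<^sub>R P \<mu> w))) (eigenvalues D A)"
    by (rule has_sum_cong_neutral[THEN iffD1, rotated -1])
      (use \<mu> eigenspaces_orthogonal[OF sa x P_in] in auto)
  ultimately have "x \<bullet> frac_power D A s w = x \<bullet> (\<mu> powr s *\<^sub>R P \<mu> w)"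
    by (rule has_sum_unique)
  then show ?thesis
    using P_orth[OF x, of w] by (simp add: inner_diff_left inner_commute[of x])
qed simp

end

section \<open>Series of eigenvectors\<close>

text \<open>
  One unit eigenvector for each of countably many distinct eigenvalues. The closed span of these
  vectors may be a proper subspace; the solution lives in it, and \<open>A\<close> and its powers act on it
  coordinatewise.
\<close>

locale eigenvector_sequence = finite_multiplicity_operator +
  fixes \<mu> :: "nat \<Rightarrow> real" and e :: "nat \<Rightarrow> 'a"
  assumes inj_\<mu>: "inj \<mu>"
    and e_in: "\<And>j. e j \<in> eigenspace D A (\<mu> j)"
    and norm_e: "\<And>j. norm (e j) = 1"
begin

lemma \<mu>_eigenvalue: "\<mu> j \<in> eigenvalues D A"
  using e_in[of j] norm_e[of j] by (force simp: eigenvalues_def)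

lemma \<mu>_pos: "\<mu> j > 0"
proof -
  obtain a where "a > 0" "a \<le> \<mu> j"
    using coercive_eigenvalues_bounded_below[OF coer] \<mu>_eigenvalue by metis
  then show ?thesis
    by simp
qed

lemma \<mu>_nonzero [simp]: "\<mu> j \<noteq> 0"
  using \<mu>_pos[of j] by simp

lemma e_in_D: "e j \<in> D" and A_e: "A (e j) = \<mu> j *\<^sub>R e j"
  using e_in[of j] by (auto simp: eigenspace_def)

lemma e_orthonormal: "e i \<bullet> e j = (if i = j then 1 else 0)"
  using eigenspaces_orthogonal[OF sa e_in e_in, of i j] norm_e[of j] inj_\<mu>
  by (auto simp: inj_eq power2_norm_eq_inner[symmetric])

definition eigen_series :: "(nat \<Rightarrow> real) \<Rightarrow> 'a" where
  "eigen_series f = (\<Sum>j. f j *\<^sub>R e j)"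

lemma eigen_series_sums:
  assumes "summable (\<lambda>j. \<bar>f j\<bar>)"
  shows "(\<lambda>j. f j *\<^sub>R e j) sums eigen_series f"
  unfolding eigen_series_def
  by (rule summable_sums, rule summable_norm_cancel) (use assms in \<open>simp add: norm_e\<close>)

lemma eigen_series_inner_sums:
  assumes "summable (\<lambda>j. \<bar>f j\<bar>)"
  shows "(\<lambda>j. f j * (e j \<bullet> z)) sums (eigen_series f \<bullet> z)"
  using bounded_linear.sums[OF bounded_linear_inner_left eigen_series_sums[OF assms], of z] by simp

lemma eigen_series_inner_e:
  assumes "summable (\<lambda>j. \<bar>f j\<bar>)"
  shows "eigen_series f \<bullet> e j = f j"
proof -
  have "(\<lambda>i. f i * (e i \<bullet> e j)) = (\<lambda>i. if i = j then f i else 0)"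
    by (auto simp: e_orthonormal)
  then show ?thesis
    using eigen_series_inner_sums[OF assms, of "e j"] sums_single[of j f] sums_unique2 by metis
qed

text \<open>
  By symmetry \<open>\<langle>A x, f j e j\<rangle> = \<langle>x, \<mu> j f j e j\<rangle>\<close> for each \<open>j\<close>, and summing this over \<open>j\<close> shows that the
  termwise image is the value of the adjoint, which is \<open>A\<close> itself.
\<close>

lemma operator_eigen_series:
  assumes f: "summable (\<lambda>j. \<bar>f j\<bar>)" and \<mu>f: "summable (\<lambda>j. \<bar>\<mu> j * f j\<bar>)"
  shows "eigen_series f \<in> D" "A (eigen_series f) = eigen_series (\<lambda>j. \<mu> j * f j)"
proof -
  have "A x \<bullet> eigen_series f = x \<bullet> eigen_series (\<lambda>j. \<mu> j * f j)" if "x \<in> D" for x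
  proof -
    have "e j \<bullet> A x = \<mu> j * (e j \<bullet> x)" for j
      using self_adjoint_symmetric[OF sa e_in_D that] by (simp add: A_e)
    then have "(\<lambda>j. (\<mu> j * f j) * (e j \<bullet> x)) sums (eigen_series f \<bullet> A x)"
      using eigen_series_inner_sums[OF f, of "A x"] by (simp add: mult_ac)
    with eigen_series_inner_sums[OF \<mu>f, of x] show ?thesis
      by (metis sums_unique2 inner_commute)
  qed
  from self_adjoint_graphI[OF sa this] show "eigen_series f \<in> D" "A (eigen_series f) = eigen_series (\<lambda>j. \<mu> j * f j)"
    by auto
qed

lemma operator_power_eigen_series:
  assumes "\<And>i. summable (\<lambda>j. \<bar>\<mu> j ^ i * f j\<bar>)"
  shows "eigen_series f \<in> power_domain D A k \<and> (A ^^ k) (eigen_series f) = eigen_series (\<lambda>j. \<mu> j ^ k * f j)"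
  using assms
proof (induction k arbitrary: f)
  case (Suc k)
  have step: "eigen_series f \<in> D" "A (eigen_series f) = eigen_series (\<lambda>j. \<mu> j * f j)"
    using Suc.prems[of 0] Suc.prems[of 1] by (auto intro: operator_eigen_series)
  have "summable (\<lambda>j. \<bar>\<mu> j ^ i * (\<mu> j * f j)\<bar>)" for i
    using Suc.prems[of "Suc i"] by (simp add: mult_ac)
  from Suc.IH[OF this] show ?case
    by (simp add: step funpow_swap1 mult_ac del: funpow.simps add: funpow_Suc_right)
qed simp

lemma P_eigen_series:
  assumes f: "summable (\<lambda>j. \<bar>f j\<bar>)"
  shows "P (\<mu> j) (eigen_series f) = f j *\<^sub>R e j"
    and "\<nu> \<notin> range \<mu> \<Longrightarrow> P \<nu> (eigen_series f) = 0"
proof -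
  show "P (\<mu> j) (eigen_series f) = f j *\<^sub>R e j"
  proof (rule P_eqI)
    show "f j *\<^sub>R e j \<in> eigenspace D A (\<mu> j)"
      using e_in subspace_eigenspace[OF sa] by (simp add: subspace_scale)
    fix z assume "z \<in> eigenspace D A (\<mu> j)"
    then have "e i \<bullet> z = 0" if "i \<noteq> j" for i
      using that eigenspaces_orthogonal[OF sa e_in, of z "\<mu> j"] inj_\<mu> by (auto simp: inj_eq)
    then have "(\<lambda>i. f i * (e i \<bullet> z)) = (\<lambda>i. if i = j then f i * (e i \<bullet> z) else 0)"
      by auto
    then show "eigen_series f \<bullet> z = (f j *\<^sub>R e j) \<bullet> z"
      using eigen_series_inner_sums[OF f, of z] sums_single[of j "\<lambda>i. f i * (e i \<bullet> z)"] sums_unique2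
      by (metis inner_scaleR_left)
  qed
  show "P \<nu> (eigen_series f) = 0" if "\<nu> \<notin> range \<mu>"
  proof (rule P_eqI)
    show "0 \<in> eigenspace D A \<nu>"
      using subspace_eigenspace[OF sa] by (simp add: subspace_0)
    fix z assume "z \<in> eigenspace D A \<nu>"
    then have "e i \<bullet> z = 0" for i
      using that eigenspaces_orthogonal[OF sa e_in, of z \<nu> i] by auto
    then show "eigen_series f \<bullet> z = 0 \<bullet> z"
      using eigen_series_inner_sums[OF f, of z] by (simp add: sums_iff)
  qed
qed

text \<open>
  The projection onto an eigenspace is \<open>f j e j\<close> if the eigenvalue is \<open>\<mu> j\<close> and 0 if it is not in the
  sequence, so the sums over the spectrum reduce to sums over \<open>j\<close>.
\<close>

lemma frac_power_eigen_series:
  assumes f: "summable (\<lambda>j. \<bar>f j\<bar>)" and sf: "summable (\<lambda>j. \<bar>\<mu> j powr s * f j\<bar>)"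
  shows "eigen_series f \<in> frac_power_domain D A s"
    and "frac_power D A s (eigen_series f) = eigen_series (\<lambda>j. \<mu> j powr s * f j)"
proof -
  have range: "range \<mu> \<subseteq> eigenvalues D A"
    using \<mu>_eigenvalue by blast
  have powr_double: "x powr (2 * s) = (x powr s)\<^sup>2" for x :: real
    by (simp add: power2_eq_square flip: powr_add)
  have "summable (\<lambda>j. \<bar>\<mu> j powr s * f j\<bar>\<^sup>2)"
  proof (rule summable_comparison_test_ev[OF _ sf])
    have square_le: "norm (\<bar>x\<bar>\<^sup>2) \<le> \<bar>x\<bar>" if "\<bar>x\<bar> < 1" for x :: real
      using that mult_left_le[of "\<bar>x\<bar>" "\<bar>x\<bar>"] by (simp add: power2_eq_square)
    have "eventually (\<lambda>j. \<bar>\<mu> j powr s * f j\<bar> < 1) sequentially"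
      using summable_LIMSEQ_zero[OF sf] by (rule order_tendstoD) simp
    then show "eventually (\<lambda>j. norm (\<bar>\<mu> j powr s * f j\<bar>\<^sup>2) \<le> \<bar>\<mu> j powr s * f j\<bar>) sequentially"
      by eventually_elim (rule square_le)
  qed
  then have "(\<lambda>j. \<bar>\<mu> j powr s * f j\<bar>\<^sup>2) summable_on UNIV"
    by (intro norm_summable_imp_summable_on) simp
  also have "(\<lambda>j. \<bar>\<mu> j powr s * f j\<bar>\<^sup>2) =
      (\<lambda>\<nu>. \<nu> powr (2 * s) * (norm (P \<nu> (eigen_series f)))\<^sup>2) \<circ> \<mu>"
    by (simp add: fun_eq_iff P_eigen_series(1)[OF f] norm_e power_mult_distrib powr_double)
  finally have "(\<lambda>\<nu>. \<nu> powr (2 * s) * (norm (P \<nu> (eigen_series f)))\<^sup>2) summable_on range \<mu>"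
    by (subst summable_on_reindex[OF inj_\<mu>])
  then show "eigen_series f \<in> frac_power_domain D A s"
    unfolding frac_power_domain_def mem_Collect_eq
    by (rule summable_on_cong_neutral[THEN iffD1, rotated -1]) (use range P_eigen_series(2)[OF f] in auto)
  have "((\<lambda>j. (\<mu> j powr s * f j) *\<^sub>R e j) has_sum eigen_series (\<lambda>j. \<mu> j powr s * f j)) UNIV"
    using eigen_series_sums[OF sf] by (intro norm_summable_imp_has_sum) (use sf in \<open>simp_all add: norm_e\<close>)
  also have "(\<lambda>j. (\<mu> j powr s * f j) *\<^sub>R e j) = (\<lambda>\<nu>. \<nu> powr s *\<^sub>R P \<nu> (eigen_series f)) \<circ> \<mu>"
    using f by (auto simp: P_eigen_series)
  finally have "((\<lambda>\<nu>. \<nu> powr s *\<^sub>R P \<nu> (eigen_series f)) has_sum eigen_series (\<lambda>j. \<mu> j powr s * f j)) (range \<mu>)"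
    by (subst has_sum_reindex[OF inj_\<mu>])
  then have "((\<lambda>\<nu>. \<nu> powr s *\<^sub>R P \<nu> (eigen_series f)) has_sum eigen_series (\<lambda>j. \<mu> j powr s * f j)) (eigenvalues D A)"
    by (rule has_sum_cong_neutral[THEN iffD1, rotated -1]) (use range P_eigen_series(2)[OF f] in auto)
  then show "frac_power D A s (eigen_series f) = eigen_series (\<lambda>j. \<mu> j powr s * f j)"
    unfolding frac_power_def by (rule infsumI)
qed

lemma continuous_on_eigen_series:
  assumes "\<And>j. continuous_on X (\<lambda>t. f t j)"
    and "\<And>t j. t \<in> X \<Longrightarrow> \<bar>f t j\<bar> \<le> M j" "summable M"
  shows "continuous_on X (\<lambda>t. eigen_series (f t))"
  unfolding eigen_series_def
  using assms by (intro continuous_on_suminf_M_test[where M = M] continuous_intros) (auto simp: norm_e)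

lemma has_vector_derivative_eigen_series:
  assumes X: "convex X" "t \<in> X"
    and der: "\<And>j s. s \<in> X \<Longrightarrow> ((\<lambda>s. f s j) has_real_derivative f' s j) (at s within X)"
    and bound: "\<And>s j. s \<in> X \<Longrightarrow> \<bar>f s j\<bar> \<le> M j" "\<And>s j. s \<in> X \<Longrightarrow> \<bar>f' s j\<bar> \<le> M j"
    and "summable M"
  shows "((\<lambda>s. eigen_series (f s)) has_vector_derivative eigen_series (f' t)) (at t within X)"
  unfolding eigen_series_def
proof (rule has_vector_derivative_suminf[where M = M and f = "\<lambda>j s. f s j *\<^sub>R e j" and
      f' = "\<lambda>j s. f' s j *\<^sub>R e j", OF X(1) _ _ \<open>summable M\<close> _ X(2)])
  fix s assume s: "s \<in> X"
  show "((\<lambda>s. f s j *\<^sub>R e j) has_vector_derivative f' s j *\<^sub>R e j) (at s within X)" for j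
    using der[OF s, of j] by (auto intro!: derivative_eq_intros)
  show "norm (f' s j *\<^sub>R e j) \<le> M j" for j
    using bound(2)[OF s] by (simp add: norm_e)
  show "summable (\<lambda>j. f s j *\<^sub>R e j)"
    using bound(1)[OF s] by (intro summable_comparison_test'[OF \<open>summable M\<close>]) (auto simp: norm_e)
qed

end

section \<open>Superposition of underdamped modes\<close>

text \<open>
  The mode at the eigenvalue \<open>\<mu> j\<close> obeys \<open>x'' + c (\<mu> j)\<^sup>\<alpha> x' + \<mu> j x = 0\<close>. The last assumption keeps the
  characteristic roots \<open>- \<sigma> j \<plusminus> i \<omega> j\<close> off the real axis, with \<open>\<omega> j\<close> comparable to the
  square root of \<open>\<mu> j\<close>. Geometric growth of \<open>\<mu>\<close> makes \<open>1 / \<mu> j\<close> summable, which makes it a dominating sequence for the series below.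
\<close>

locale damped_modes = eigenvector_sequence +
  fixes c \<alpha> C :: real
  assumes c_pos: "c > 0" and \<alpha>_pos: "\<alpha> > 0" and C_gt_1: "C > 1"
    and \<mu>0_ge_1: "\<mu> 0 \<ge> 1"
    and lacunary: "\<And>j. C * \<mu> j \<le> \<mu> (Suc j)"
    and underdamped: "\<And>j. c * \<mu> j powr \<alpha> \<le> sqrt (\<mu> j)"
begin

definition \<sigma> :: "nat \<Rightarrow> real" where "\<sigma> j = c * \<mu> j powr \<alpha> / 2"
definition \<omega> :: "nat \<Rightarrow> real" where "\<omega> j = sqrt (\<mu> j - (\<sigma> j)\<^sup>2)"

text \<open>
  The weight \<open>1 / (\<mu> j)\<^sup>2\<close> pays for the two time derivatives, each of which costs up to a square root of
  \<open>\<mu> j\<close>, and leaves a summable factor \<open>1 / \<mu> j\<close>; being polynomial, it is negligible against the growth of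
  \<open>(\<mu> j)\<^sup>k\<close>.
\<close>

definition cosine_mode :: "real \<Rightarrow> nat \<Rightarrow> real" where
  "cosine_mode t j = exp (- \<sigma> j * t) * cos (\<omega> j * t) / \<mu> j ^ 2"
definition sine_mode :: "real \<Rightarrow> nat \<Rightarrow> real" where
  "sine_mode t j = exp (- \<sigma> j * t) * sin (\<omega> j * t) / \<mu> j ^ 2"
definition mode_deriv :: "real \<Rightarrow> nat \<Rightarrow> real" where
  "mode_deriv t j = - \<sigma> j * cosine_mode t j - \<omega> j * sine_mode t j"
definition mode_deriv2 :: "real \<Rightarrow> nat \<Rightarrow> real" where
  "mode_deriv2 t j = ((\<sigma> j)\<^sup>2 - (\<omega> j)\<^sup>2) * cosine_mode t j + 2 * \<sigma> j * \<omega> j * sine_mode t j"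

lemma \<mu>_ge_power: "C ^ j \<le> \<mu> j"
proof (induction j)
  case (Suc j)
  then have "C * C ^ j \<le> C * \<mu> j"
    using C_gt_1 by simp
  then show ?case
    using lacunary[of j] by simp
qed (use \<mu>0_ge_1 in simp)

lemma \<mu>_ge_1: "\<mu> j \<ge> 1"
  using \<mu>_ge_power[of j] one_le_power[of C j] C_gt_1 by linarith

lemma \<mu>_unbounded: "\<exists>j. \<mu> j \<ge> y"
proof -
  obtain j where "y < C ^ j"
    using real_arch_pow[OF C_gt_1] by blast
  then show ?thesis
    using \<mu>_ge_power[of j] by (intro exI[of _ j]) linarith
qed

lemma summable_inverse_\<mu>: "summable (\<lambda>j. K / \<mu> j)"
proof -
  have "summable (\<lambda>j. 1 / \<mu> j)"
  proof (rule summable_comparison_test')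
    show "summable (\<lambda>j. (1 / C) ^ j)"
      using C_gt_1 by (intro summable_geometric) simp
    show "norm (1 / \<mu> j) \<le> (1 / C) ^ j" for j
      using \<mu>_ge_power[of j] \<mu>_pos[of j] C_gt_1 by (simp add: power_one_over frac_le)
  qed
  from summable_mult[OF this, of K] show ?thesis
    by simp
qed

lemma \<sigma>_pos: "\<sigma> j > 0"
  using c_pos \<mu>_pos[of j] by (simp add: \<sigma>_def)

lemma \<sigma>_squared_le: "(\<sigma> j)\<^sup>2 \<le> \<mu> j / 4"
proof -
  have "(\<sigma> j)\<^sup>2 \<le> (sqrt (\<mu> j) / 2)\<^sup>2"
    using underdamped[of j] \<sigma>_pos[of j] by (intro power_mono) (auto simp: \<sigma>_def)
  then show ?thesis
    using \<mu>_pos[of j] by (simp add: power_divide)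
qed

lemma \<omega>_nonneg: "\<omega> j \<ge> 0"
  and \<omega>_squared: "(\<omega> j)\<^sup>2 = \<mu> j - (\<sigma> j)\<^sup>2"
  using \<sigma>_squared_le[of j] \<mu>_pos[of j] by (simp_all add: \<omega>_def)

lemma \<omega>_ge: "\<omega> j \<ge> sqrt (\<mu> j) / 2"
proof -
  have "(sqrt (\<mu> j) / 2)\<^sup>2 \<le> (\<omega> j)\<^sup>2"
    using \<sigma>_squared_le[of j] \<mu>_pos[of j] by (simp add: \<omega>_squared power_divide)
  then show ?thesis
    using \<omega>_nonneg by (rule power2_le_imp_le)
qed

lemma cosine_mode_has_derivative:
  "((\<lambda>s. cosine_mode s j) has_real_derivative mode_deriv t j) (at t within X)"
  unfolding cosine_mode_def mode_deriv_def sine_mode_def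
  using \<mu>_pos[of j] by (auto intro!: derivative_eq_intros simp: field_simps)

lemma sine_mode_has_derivative:
  "((\<lambda>s. sine_mode s j) has_real_derivative - \<sigma> j * sine_mode t j + \<omega> j * cosine_mode t j) (at t within X)"
  unfolding cosine_mode_def sine_mode_def
  using \<mu>_pos[of j] by (auto intro!: derivative_eq_intros simp: field_simps)

lemma mode_deriv_has_derivative:
  "((\<lambda>s. mode_deriv s j) has_real_derivative mode_deriv2 t j) (at t within X)"
  unfolding mode_deriv_def
  by (rule derivative_eq_intros cosine_mode_has_derivative sine_mode_has_derivative refl)+
    (simp add: mode_deriv2_def mode_deriv_def algebra_simps power2_eq_square)

lemma damped_oscillator:
  "mode_deriv2 t j + \<mu> j * cosine_mode t j + c * \<mu> j powr \<alpha> * mode_deriv t j = 0"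
proof -
  have "c * \<mu> j powr \<alpha> = 2 * \<sigma> j"
    by (simp add: \<sigma>_def)
  moreover have "\<mu> j = (\<omega> j)\<^sup>2 + (\<sigma> j)\<^sup>2"
    by (simp add: \<omega>_squared)
  ultimately show ?thesis
    unfolding mode_deriv2_def mode_deriv_def by algebra
qed

lemma mode_bounds:
  assumes "t \<ge> 0"
  shows "\<bar>cosine_mode t j\<bar> \<le> exp (- \<sigma> j * t) / \<mu> j ^ 2" "\<bar>cosine_mode t j\<bar> \<le> 1 / \<mu> j ^ 2"
    and "\<bar>sine_mode t j\<bar> \<le> 1 / \<mu> j ^ 2"
proof -
  have e1: "exp (- \<sigma> j * t) \<le> 1"
    using assms \<sigma>_pos[of j] by simp
  have trig: "\<bar>exp (- \<sigma> j * t) * r / \<mu> j ^ 2\<bar> \<le> exp (- \<sigma> j * t) / \<mu> j ^ 2" if "\<bar>r\<bar> \<le> 1" for r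
    using that by (simp add: abs_mult divide_right_mono mult_left_le)
  have le1: "exp (- \<sigma> j * t) / \<mu> j ^ 2 \<le> 1 / \<mu> j ^ 2"
    using e1 by (intro divide_right_mono) auto
  show "\<bar>cosine_mode t j\<bar> \<le> exp (- \<sigma> j * t) / \<mu> j ^ 2"
    unfolding cosine_mode_def by (rule trig) simp
  then show "\<bar>cosine_mode t j\<bar> \<le> 1 / \<mu> j ^ 2"
    using le1 by linarith
  show "\<bar>sine_mode t j\<bar> \<le> 1 / \<mu> j ^ 2"
    unfolding sine_mode_def using trig[of "sin (\<omega> j * t)"] le1 by (smt (verit) abs_sin_le_one)
qed

lemma mode_derivs_bound:
  assumes "t \<ge> 0"
  shows "\<bar>cosine_mode t j\<bar> \<le> 2 / \<mu> j" "\<bar>mode_deriv t j\<bar> \<le> 2 / \<mu> j" "\<bar>mode_deriv2 t j\<bar> \<le> 2 / \<mu> j"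
proof -
  \<comment> \<open>Both derivatives are combinations of the two modes with coefficients at most \<open>\<mu> j\<close>.\<close>
  have combination_bound: "\<bar>a * cosine_mode t j + b * sine_mode t j\<bar> \<le> 2 / \<mu> j"
    if "\<bar>a\<bar> \<le> \<mu> j" "\<bar>b\<bar> \<le> \<mu> j" for a b
  proof -
    have "\<bar>a * cosine_mode t j\<bar> \<le> \<mu> j * (1 / \<mu> j ^ 2)"
      unfolding abs_mult using that mode_bounds[OF assms] \<mu>_pos[of j] by (intro mult_mono) auto
    moreover have "\<bar>b * sine_mode t j\<bar> \<le> \<mu> j * (1 / \<mu> j ^ 2)"
      unfolding abs_mult using that mode_bounds[OF assms] \<mu>_pos[of j] by (intro mult_mono) auto
    moreover have "\<mu> j * (1 / \<mu> j ^ 2) = 1 / \<mu> j"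
      by (simp add: power2_eq_square)
    ultimately show ?thesis
      using abs_triangle_ineq[of "a * cosine_mode t j" "b * sine_mode t j"] by simp
  qed
  have root_le: "r \<le> \<mu> j" if "r\<^sup>2 \<le> \<mu> j" for r
  proof -
    have "\<mu> j \<le> (\<mu> j)\<^sup>2"
      using \<mu>_ge_1[of j] by (simp add: power2_eq_square)
    then show ?thesis
      using that \<mu>_pos[of j] by (intro power2_le_imp_le[of r "\<mu> j"]) auto
  qed
  have sq: "(\<sigma> j)\<^sup>2 \<ge> 0" "(\<omega> j)\<^sup>2 \<ge> 0" "(\<sigma> j)\<^sup>2 + (\<omega> j)\<^sup>2 = \<mu> j"
    by (simp, simp, simp add: \<omega>_squared)
  have "\<bar>(\<sigma> j)\<^sup>2 - (\<omega> j)\<^sup>2\<bar> \<le> \<mu> j"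
    using sq by linarith
  moreover have "\<bar>2 * \<sigma> j * \<omega> j\<bar> \<le> \<mu> j"
    using sq(3) sum_squares_bound[of "\<sigma> j" "\<omega> j"] \<sigma>_pos[of j] \<omega>_nonneg[of j] by (simp add: abs_mult)
  ultimately show "\<bar>mode_deriv2 t j\<bar> \<le> 2 / \<mu> j"
    unfolding mode_deriv2_def by (rule combination_bound)
  have "\<sigma> j \<le> \<mu> j"
    by (rule root_le) (use sq in linarith)
  moreover have "\<omega> j \<le> \<mu> j"
    by (rule root_le) (use sq in linarith)
  ultimately show "\<bar>mode_deriv t j\<bar> \<le> 2 / \<mu> j"
    using combination_bound[of "- \<sigma> j" "- \<omega> j"] \<sigma>_pos[of j] \<omega>_nonneg[of j] by (simp add: mode_deriv_def)
  show "\<bar>cosine_mode t j\<bar> \<le> 2 / \<mu> j"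
    using combination_bound[of 1 0] \<mu>_ge_1[of j] by simp
qed

lemma summable_modes:
  assumes "t \<ge> 0"
  shows "summable (\<lambda>j. \<bar>cosine_mode t j\<bar>)" "summable (\<lambda>j. \<bar>mode_deriv t j\<bar>)"
    "summable (\<lambda>j. \<bar>mode_deriv2 t j\<bar>)"
  using mode_derivs_bound[OF assms]
  by (auto intro!: summable_comparison_test'[OF summable_inverse_\<mu>[of 2]])

lemma half_power_mode_bound:
  assumes "t \<ge> 0"
  shows "\<bar>\<mu> j powr (1/2) * cosine_mode t j\<bar> \<le> 1 / \<mu> j"
proof -
  have "\<mu> j powr (1/2) \<le> \<mu> j powr 1"
    using \<mu>_ge_1[of j] by (intro powr_mono) auto
  then have "\<bar>\<mu> j powr (1/2) * cosine_mode t j\<bar> \<le> \<mu> j * (1 / \<mu> j ^ 2)"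
    unfolding abs_mult using mode_bounds[OF assms] \<mu>_pos[of j] by (intro mult_mono) auto
  then show ?thesis
    by (simp add: power2_eq_square)
qed

text \<open>
  The series and its first two termwise derivatives converge uniformly on \<open>[0,\<infinity>)\<close>, so the second
  derivative even exists in the norm of \<open>H\<close>. Tested against \<open>w\<close>, the equation splits into the
  scalar oscillator equations of the modes.
\<close>

lemma energy_solution_modes:
  assumes "\<alpha> \<le> 1"
  shows "energy_solution D A c \<alpha> (eigen_series (cosine_mode 0)) (eigen_series (mode_deriv 0)) (\<lambda>t. eigen_series (cosine_mode t))"
proof -
  define v where "v t = eigen_series (mode_deriv t)" for t
  have cont: "continuous_on X (\<lambda>t. cosine_mode t j)" "continuous_on X (\<lambda>t. mode_deriv t j)"
    "continuous_on X (\<lambda>t. mode_deriv2 t j)" for X j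
    unfolding cosine_mode_def mode_deriv2_def mode_deriv_def sine_mode_def
    using \<mu>_pos[of j] by (auto intro!: continuous_intros)
  have half_summable: "summable (\<lambda>j. \<bar>\<mu> j powr (1/2) * cosine_mode t j\<bar>)" if "t \<ge> 0" for t
    using half_power_mode_bound[OF that]
    by (auto intro!: summable_comparison_test'[OF summable_inverse_\<mu>[of 1]])
  note half = frac_power_eigen_series[OF summable_modes(1) half_summable]
  have "continuous_on {0..} (\<lambda>t. eigen_series (\<lambda>j. \<mu> j powr (1/2) * cosine_mode t j))"
    by (rule continuous_on_eigen_series[where M = "\<lambda>j. 1 / \<mu> j"])
      (auto intro!: continuous_intros cont half_power_mode_bound summable_inverse_\<mu>)
  then have half_cont: "continuous_on {0..} (\<lambda>t. frac_power D A (1/2) (eigen_series (cosine_mode t)))"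
    by (rule continuous_on_eq) (use half in auto)
  have u_cont: "continuous_on {0..} (\<lambda>t. eigen_series (cosine_mode t))"
    by (rule continuous_on_eigen_series[where M = "\<lambda>j. 2 / \<mu> j"])
      (auto intro!: cont mode_derivs_bound summable_inverse_\<mu>)
  have v_cont: "continuous_on {0..} v"
    unfolding v_def by (rule continuous_on_eigen_series[where M = "\<lambda>j. 2 / \<mu> j"])
      (auto intro!: cont mode_derivs_bound summable_inverse_\<mu>)
  have v'_cont: "continuous_on {0..} (\<lambda>t. eigen_series (mode_deriv2 t))"
    by (rule continuous_on_eigen_series[where M = "\<lambda>j. 2 / \<mu> j"])
      (auto intro!: cont mode_derivs_bound summable_inverse_\<mu>)
  have u_deriv: "((\<lambda>t. eigen_series (cosine_mode t)) has_vector_derivative v t) (at t within {0..})"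
    if "t \<ge> 0" for t
    unfolding v_def using that
    by (intro has_vector_derivative_eigen_series[where M = "\<lambda>j. 2 / \<mu> j"])
      (auto intro!: cosine_mode_has_derivative mode_derivs_bound summable_inverse_\<mu>)
  have v_deriv: "(v has_vector_derivative eigen_series (mode_deriv2 t)) (at t within {0..})"
    if "t \<ge> 0" for t
    unfolding v_def using that
    by (intro has_vector_derivative_eigen_series[where M = "\<lambda>j. 2 / \<mu> j"])
      (auto intro!: mode_deriv_has_derivative mode_derivs_bound summable_inverse_\<mu>)
  have weak: "((\<lambda>s. v s \<bullet> w) has_real_derivative eigen_series (mode_deriv2 t) \<bullet> w) (at t within {0..})"
    if "t \<ge> 0" for t w
    using bounded_linear.has_vector_derivative[OF bounded_linear_inner_left v_deriv[OF that], of w]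
    by (simp add: has_real_derivative_iff_has_vector_derivative)
  have eq: "eigen_series (mode_deriv2 t) \<bullet> w + eigen_series (cosine_mode t) \<bullet> A w + c * (v t \<bullet> frac_power D A \<alpha> w) = 0"
    if t: "t \<ge> 0" and w: "w \<in> D" for t w
  proof -
    have "e j \<bullet> A w = \<mu> j * (e j \<bullet> w)" for j
      using self_adjoint_symmetric[OF sa e_in_D w] by (simp add: A_e)
    moreover have "e j \<bullet> frac_power D A \<alpha> w = \<mu> j powr \<alpha> * (e j \<bullet> w)" for j
      by (rule inner_frac_power[OF w assms e_in])
    ultimately have "(\<lambda>j. mode_deriv2 t j * (e j \<bullet> w) + cosine_mode t j * (\<mu> j * (e j \<bullet> w))
          + c * (mode_deriv t j * (\<mu> j powr \<alpha> * (e j \<bullet> w))))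
        sums (eigen_series (mode_deriv2 t) \<bullet> w + eigen_series (cosine_mode t) \<bullet> A w + c * (v t \<bullet> frac_power D A \<alpha> w))"
      using eigen_series_inner_sums[OF summable_modes(3)[OF t], of w]
        eigen_series_inner_sums[OF summable_modes(1)[OF t], of "A w"]
        eigen_series_inner_sums[OF summable_modes(2)[OF t], of "frac_power D A \<alpha> w"]
      unfolding v_def by (intro sums_add sums_mult) simp_all
    moreover have "mode_deriv2 t j * (e j \<bullet> w) + cosine_mode t j * (\<mu> j * (e j \<bullet> w))
          + c * (mode_deriv t j * (\<mu> j powr \<alpha> * (e j \<bullet> w))) = 0" for j
    proof -
      have "mode_deriv2 t j * (e j \<bullet> w) + cosine_mode t j * (\<mu> j * (e j \<bullet> w))
          + c * (mode_deriv t j * (\<mu> j powr \<alpha> * (e j \<bullet> w)))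
        = (mode_deriv2 t j + \<mu> j * cosine_mode t j + c * \<mu> j powr \<alpha> * mode_deriv t j) * (e j \<bullet> w)"
        by (simp add: algebra_simps)
      then show ?thesis
        by (simp only: damped_oscillator mult_zero_left)
    qed
    ultimately show ?thesis
      by (simp add: sums_iff)
  qed
  have "\<exists>d. continuous_on {0..} d \<and> (\<forall>t\<ge>0. ((\<lambda>s. v s \<bullet> w) has_real_derivative d t) (at t within {0..})
      \<and> d t + eigen_series (cosine_mode t) \<bullet> A w + c * (v t \<bullet> frac_power D A \<alpha> w) = 0)" if "w \<in> D" for w
    using weak eq[OF _ that] v'_cont
    by (intro exI[of _ "\<lambda>t. eigen_series (mode_deriv2 t) \<bullet> w"]) (auto intro!: continuous_intros)
  then show ?thesis
    unfolding energy_solution_def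
    using half(1) half_cont u_cont v_cont u_deriv by (auto intro!: exI[of _ v] simp: v_def)
qed

section \<open>Smoothing and the lower bound\<close>

text \<open>
  For positive times the damping factor \<open>exp (- \<sigma> j t)\<close>, with \<open>\<sigma> j\<close> a multiple of \<open>(\<mu> j)\<^sup>\<alpha>\<close>, beats every
  power of \<open>\<mu> j\<close>. This is the smoothing effect of the equation.
\<close>

lemma mode_power_bound:
  assumes "t > 0"
  shows "\<exists>K. \<forall>s\<ge>t. \<forall>j. \<bar>\<mu> j ^ i * cosine_mode s j\<bar> \<le> K / \<mu> j"
proof -
  have "c / 2 * t > 0"
    using c_pos assms by simp
  from power_times_exp_powr_bounded[OF \<alpha>_pos this, of i] obtain K where
    K: "\<And>x. x \<ge> 1 \<Longrightarrow> x ^ i * exp (- (c / 2 * t * x powr \<alpha>)) \<le> K"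
    by blast
  have "\<bar>\<mu> j ^ i * cosine_mode s j\<bar> \<le> K / \<mu> j" if s: "s \<ge> t" for s j
  proof -
    have "\<bar>\<mu> j ^ i * cosine_mode s j\<bar> \<le> \<mu> j ^ i * (exp (- \<sigma> j * s) / \<mu> j ^ 2)"
      unfolding abs_mult using mode_bounds(1)[of s j] s assms \<mu>_pos[of j] by (intro mult_mono) auto
    also have "\<dots> \<le> \<mu> j ^ i * (exp (- \<sigma> j * t) / \<mu> j ^ 2)"
      using s \<sigma>_pos[of j] \<mu>_pos[of j] by (intro mult_left_mono divide_right_mono) auto
    also have "\<dots> = \<mu> j ^ i * exp (- (c / 2 * t * \<mu> j powr \<alpha>)) / \<mu> j ^ 2"
      by (simp add: \<sigma>_def mult_ac)
    also have "\<dots> \<le> K / \<mu> j ^ 2"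
      using K[OF \<mu>_ge_1] by (intro divide_right_mono) auto
    also have "\<dots> \<le> K / \<mu> j"
    proof -
      have "K \<ge> 0"
        by (rule order_trans[OF _ K[of 1]]) simp_all
      then show ?thesis
        using \<mu>_ge_1[of j] \<mu>_pos[of j] by (intro divide_left_mono) (auto simp: power2_eq_square)
    qed
    finally show ?thesis .
  qed
  then show ?thesis
    by blast
qed

lemma operator_power_modes:
  assumes "t > 0"
  shows "eigen_series (cosine_mode t) \<in> power_domain D A k"
    and "(A ^^ k) (eigen_series (cosine_mode t)) = eigen_series (\<lambda>j. \<mu> j ^ k * cosine_mode t j)"
    and "summable (\<lambda>j. \<bar>\<mu> j ^ k * cosine_mode t j\<bar>)"
proof -
  have summ: "summable (\<lambda>j. \<bar>\<mu> j ^ i * cosine_mode t j\<bar>)" for i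
  proof -
    obtain K where "\<And>j. \<bar>\<mu> j ^ i * cosine_mode t j\<bar> \<le> K / \<mu> j"
      using mode_power_bound[OF assms, of i] by blast
    then show ?thesis
      by (intro summable_comparison_test'[OF summable_inverse_\<mu>[of K]]) auto
  qed
  then show "summable (\<lambda>j. \<bar>\<mu> j ^ k * cosine_mode t j\<bar>)" .
  from operator_power_eigen_series[OF summ, of k] show "eigen_series (cosine_mode t) \<in> power_domain D A k"
    and "(A ^^ k) (eigen_series (cosine_mode t)) = eigen_series (\<lambda>j. \<mu> j ^ k * cosine_mode t j)"
    by auto
qed

text \<open>
  The norm dominates each coordinate, and over the interval the coordinate \<open>j\<close> keeps at least its
  damping at the final time \<open>\<theta>\<close> and a quarter of the length.
\<close>

lemma integral_ge_single_mode:
  assumes t: "0 < t" "t < \<theta>" and osc: "\<omega> j * (\<theta> - t) \<ge> 2"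
  shows "integral {t..\<theta>} (\<lambda>s. (norm ((A ^^ k) (eigen_series (cosine_mode s))))\<^sup>2)
      \<ge> \<mu> j ^ (2 * k) / \<mu> j ^ 4 * exp (- (c * \<theta>) * \<mu> j powr \<alpha>) * ((\<theta> - t) / 4)"
proof -
  define a where "a = \<mu> j ^ (2 * k) / \<mu> j ^ 4 * exp (- (c * \<theta>) * \<mu> j powr \<alpha>)"
  have a: "a \<ge> 0"
    using \<mu>_pos[of j] by (simp add: a_def)
  obtain K where K: "\<And>s j. s \<ge> t \<Longrightarrow> \<bar>\<mu> j ^ k * cosine_mode s j\<bar> \<le> K / \<mu> j"
    using mode_power_bound[OF t(1), of k] by blast
  \<comment> \<open>Integrability matters, as the integral of a non-integrable function has the default value 0.\<close>
  have "continuous_on {t..\<theta>} (\<lambda>s. eigen_series (\<lambda>j. \<mu> j ^ k * cosine_mode s j))"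
    using K \<mu>_pos by (intro continuous_on_eigen_series[where M = "\<lambda>j. K / \<mu> j"] summable_inverse_\<mu>)
      (auto simp: cosine_mode_def intro!: continuous_intros)
  then have "continuous_on {t..\<theta>} (\<lambda>s. (A ^^ k) (eigen_series (cosine_mode s)))"
    by (rule continuous_on_eq) (use t operator_power_modes(2) in auto)
  then have int: "(\<lambda>s. (norm ((A ^^ k) (eigen_series (cosine_mode s))))\<^sup>2) integrable_on {t..\<theta>}"
    by (intro integrable_continuous_interval continuous_intros)
  have pointwise: "a * (cos (\<omega> j * s))\<^sup>2 \<le> (norm ((A ^^ k) (eigen_series (cosine_mode s))))\<^sup>2"
    if s: "s \<in> {t..\<theta>}" for s
  proof -
    have s0: "s > 0"
      using s t by auto
    have "exp (- (c * \<theta>) * \<mu> j powr \<alpha>) \<le> exp (- \<sigma> j * s) ^ 2"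
      using s c_pos by (simp add: \<sigma>_def exp_of_nat_mult[symmetric] mult_right_mono)
    then have "a * (cos (\<omega> j * s))\<^sup>2
        \<le> \<mu> j ^ (2 * k) / \<mu> j ^ 4 * exp (- \<sigma> j * s) ^ 2 * (cos (\<omega> j * s))\<^sup>2"
      unfolding a_def using \<mu>_pos[of j] by (intro mult_right_mono mult_left_mono) auto
    also have "\<dots> = (\<mu> j ^ k * cosine_mode s j)\<^sup>2"
      by (simp add: cosine_mode_def power_mult_distrib power_divide power_mult[symmetric] mult.commute)
    also have "\<mu> j ^ k * cosine_mode s j = (A ^^ k) (eigen_series (cosine_mode s)) \<bullet> e j"
      using operator_power_modes[OF s0, of k] by (simp add: eigen_series_inner_e)
    also have "\<dots>\<^sup>2 \<le> (norm ((A ^^ k) (eigen_series (cosine_mode s))))\<^sup>2"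
      using Cauchy_Schwarz_ineq2[of "(A ^^ k) (eigen_series (cosine_mode s))" "e j"]
      by (simp add: norm_e power2_le_iff_abs_le)
    finally show ?thesis .
  qed
  have "a * ((\<theta> - t) / 4) \<le> a * integral {t..\<theta>} (\<lambda>s. (cos (\<omega> j * s))\<^sup>2)"
    using integral_cos_squared_ge[OF t(2) osc] a by (rule mult_left_mono)
  also have "\<dots> = integral {t..\<theta>} (\<lambda>s. a * (cos (\<omega> j * s))\<^sup>2)"
    by simp
  also have "\<dots> \<le> integral {t..\<theta>} (\<lambda>s. (norm ((A ^^ k) (eigen_series (cosine_mode s))))\<^sup>2)"
    using pointwise by (intro integral_le[OF _ int] integrable_continuous_interval continuous_intros) auto
  finally show ?thesis
    by (simp add: a_def)
qed

text \<open>
  The mode used for the power \<open>k\<close> is the one with \<open>(\<mu> j)\<^sup>\<alpha>\<close> proportional to \<open>k\<close>, the scale at which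
  \<open>\<mu>\<^sup>2\<^sup>k exp (- c \<theta> \<mu>\<^sup>\<alpha>)\<close> is largest up to factors exponential in \<open>k\<close>. The
  scaling constant \<open>M\<close> pushes \<open>\<mu> j\<close> so far up that the mode oscillates fast compared with
  \<open>\<theta> - t\<close>; enlarging \<open>M\<close> instead of \<open>k\<close> gives the estimate for all \<open>k \<ge> 1\<close>.
\<close>

lemma integral_operator_power_lower_bound:
  assumes ratio: "\<And>j. \<mu> (Suc j) \<le> C' * \<mu> j" "C' \<ge> 1" and t: "0 < t" "t < \<theta>" and k: "k \<ge> 1"
  defines "M \<equiv> max (\<mu> 0) (16 / (\<theta> - t)\<^sup>2)"
  shows "((exp (- (c * \<theta> + 4/\<alpha>) * (C' * M) powr \<alpha>) * min 1 ((\<theta> - t) / 4)) powr (\<alpha>/2) * real k)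
        powr (2 * real k / \<alpha>)
      \<le> integral {t..\<theta>} (\<lambda>s. (norm ((A ^^ k) (eigen_series (cosine_mode s))))\<^sup>2)"
proof -
  define X where "X = M * real k powr (1/\<alpha>)"
  have M: "M \<ge> 1" "M \<ge> \<mu> 0" "M \<ge> 16 / (\<theta> - t)\<^sup>2"
    using \<mu>_ge_1[of 0] by (auto simp: M_def)
  have "real k powr (1/\<alpha>) \<ge> 1"
    using k \<alpha>_pos by (intro ge_one_powr_ge_zero) auto
  then have X: "X \<ge> M"
    unfolding X_def using mult_left_mono[of 1 "real k powr (1/\<alpha>)" M] M(1) by simp
  have "\<exists>j\<ge>0. X \<le> \<mu> j \<and> \<mu> j \<le> C' * X"
    using ratio \<mu>_unbounded M X by (intro exists_term_within_ratio) auto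
  then obtain j where j: "X \<le> \<mu> j" "\<mu> j \<le> C' * X"
    by blast
  have "4 / (\<theta> - t) = sqrt (16 / (\<theta> - t)\<^sup>2)"
    using t by (simp add: real_sqrt_divide)
  also have "\<dots> \<le> sqrt (\<mu> j)"
    using M(3) X j(1) by simp
  finally have "2 / (\<theta> - t) \<le> \<omega> j"
    using \<omega>_ge[of j] by simp
  then have osc: "\<omega> j * (\<theta> - t) \<ge> 2"
    using t by (simp add: field_simps)
  have "((exp (- (c * \<theta> + 4/\<alpha>) * (C' * M) powr \<alpha>) * min 1 ((\<theta> - t) / 4)) powr (\<alpha>/2) * real k)
        powr (2 * real k / \<alpha>)
      \<le> \<mu> j ^ (2 * k) / \<mu> j ^ 4 * exp (- (c * \<theta>) * \<mu> j powr \<alpha>) * ((\<theta> - t) / 4)"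
    using \<alpha>_pos k M(1) c_pos t j unfolding X_def by (intro mode_lower_bound) auto
  also have "\<dots> \<le> integral {t..\<theta>} (\<lambda>s. (norm ((A ^^ k) (eigen_series (cosine_mode s))))\<^sup>2)"
    by (rule integral_ge_single_mode[OF t osc])
  finally show ?thesis .
qed

end

section \<open>Choice of the eigenvalues and the conclusion\<close>

lemma eigenvalue_sequence_eigenspace_finite:
  assumes "eigenvalue_sequence D A ev"
  shows "\<exists>B. finite B \<and> span B = eigenspace D A \<nu>"
  using assms unfolding eigenvalue_sequence_def by blast

text \<open>
  A value taken at least once has a nonempty basis of its eigenspace.
\<close>

lemma eigenvalue_sequence_in_eigenvalues:
  assumes "eigenvalue_sequence D A ev" "n \<ge> 1"
  shows "ev n \<in> eigenvalues D A"
proof -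
  obtain B where B: "independent B" "span B = eigenspace D A (ev n)"
      "card B = card {m. m \<ge> 1 \<and> ev m = ev n}" and fin: "finite {m. m \<ge> 1 \<and> ev m = ev n}"
    using assms(1) unfolding eigenvalue_sequence_def by blast
  have "card {m. m \<ge> 1 \<and> ev m = ev n} \<noteq> 0"
    using fin assms(2) by auto
  then obtain b where "b \<in> B"
    using B(3) by fastforce
  then have "b \<in> eigenspace D A (ev n)" "b \<noteq> 0"
    using B span_base dependent_zero by blast+
  then show ?thesis
    by (auto simp: eigenvalues_def)
qed

text \<open>
  Iterating \<open>exists_term_within_ratio\<close> from \<open>C x\<close> costs one factor \<open>C\<close> for the step and one for the
  overshoot, hence the upper ratio \<open>C\<^sup>2\<close>.
\<close>

lemma lacunary_sequence_exists:
  fixes ev :: "nat \<Rightarrow> real"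
  assumes ratio: "\<And>n. n \<ge> m \<Longrightarrow> ev (Suc n) \<le> C * ev n" and C: "C > 1"
    and unbounded: "\<And>y. \<exists>n\<ge>m. ev n \<ge> y"
  shows "\<exists>\<mu>. \<forall>j. \<mu> j \<in> ev ` {m..} \<and> R \<le> \<mu> j \<and> C * \<mu> j \<le> \<mu> (Suc j) \<and> \<mu> (Suc j) \<le> C\<^sup>2 * \<mu> j"
proof -
  \<comment> \<open>Staying above \<open>ev m\<close> lets the search for the next term start at index \<open>m\<close>; the 1 keeps terms positive.\<close>
  define R' where "R' = max (max 1 R) (ev m)"
  have "\<exists>\<mu>. \<forall>j. (\<mu> j \<in> ev ` {m..} \<and> R' \<le> \<mu> j) \<and> C * \<mu> j \<le> \<mu> (Suc j) \<and> \<mu> (Suc j) \<le> C\<^sup>2 * \<mu> j"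
  proof (rule dependent_nat_choice)
    show "\<exists>x. x \<in> ev ` {m..} \<and> R' \<le> x"
      using unbounded[of R'] by auto
    fix x :: real and j :: nat assume x: "x \<in> ev ` {m..} \<and> R' \<le> x"
    then have "x > 0" "ev m \<le> x"
      by (auto simp: R'_def)
    then have "x < C * x"
      using C by simp
    with \<open>x > 0\<close> \<open>ev m \<le> x\<close> have Cx: "x < C * x" "ev m \<le> C * x" "0 < C * x"
      by linarith+
    then have "\<exists>n\<ge>m. C * x \<le> ev n \<and> ev n \<le> C * (C * x)"
      using ratio unbounded C by (intro exists_term_within_ratio) auto
    then obtain n where n: "n \<ge> m" "C * x \<le> ev n" "ev n \<le> C * (C * x)"
      by blast
    then show "\<exists>y. (y \<in> ev ` {m..} \<and> R' \<le> y) \<and> C * x \<le> y \<and> y \<le> C\<^sup>2 * x"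
      using x Cx by (intro exI[of _ "ev n"]) (auto simp: power2_eq_square mult.assoc)
  qed
  then show ?thesis
    by (force simp: R'_def)
qed

theorem theorem4p2:
  fixes D :: "'a::{real_inner, banach} set"
    and A :: "'a \<Rightarrow> 'a"
    and ev :: "nat \<Rightarrow> real"
    and c \<alpha> :: real
  assumes inf_dim: "\<not> (\<exists>B::'a set. finite B \<and> span B = UNIV)"
    and sa: "self_adjoint D A"
    and coer: "coercive D A"
    and cpt: "has_compact_inverse D A"
    and ev: "eigenvalue_sequence D A ev"
    and growth: "\<exists>\<epsilon>>0. \<exists>\<delta>>0. \<forall>n\<ge>1. ev n \<ge> \<delta> * real n powr \<epsilon>"
    and gaps: "\<exists>C>1. \<forall>n\<ge>1. ev (n + 1) \<le> C * ev n"
    and c: "c > 0"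
    and alpha: "0 < \<alpha>" "\<alpha> < 1/2"
  shows "\<exists>u0 u1 u. \<exists>n0::nat. \<exists>\<delta> :: real \<Rightarrow> real \<Rightarrow> real.
           u0 \<in> frac_power_domain D A (1/2) \<and>
           energy_solution D A c \<alpha> u0 u1 u \<and>
           (\<forall>k. \<forall>t>0. u t \<in> power_domain D A k) \<and>
           n0 \<ge> 1 \<and>
           (\<forall>t \<theta>. 0 < t \<and> t < \<theta> \<longrightarrow> \<delta> t \<theta> > 0) \<and>
           (\<forall>k\<ge>n0. \<forall>t>0. \<forall>\<theta>>t.
              integral {t..\<theta>} (\<lambda>s. (norm ((A ^^ k) (u s)))\<^sup>2)
                \<ge> (\<delta> t \<theta> * real k) powr (2 * real k / \<alpha>))"
proof -
  obtain C where C: "C > 1" "\<And>n. n \<ge> 1 \<Longrightarrow> ev (Suc n) \<le> C * ev n"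
    using gaps by auto
  have unbounded: "\<exists>n\<ge>1. ev n \<ge> y" for y
  proof -
    obtain \<epsilon> \<delta> where \<delta>: "\<epsilon> > 0" "\<delta> > 0" "\<And>n. n \<ge> 1 \<Longrightarrow> ev n \<ge> \<delta> * real n powr \<epsilon>"
      using growth by blast
    have "filterlim (\<lambda>n. \<delta> * real n powr \<epsilon>) at_top sequentially"
      using \<delta>(1,2) by real_asymp
    then have "eventually (\<lambda>n. n \<ge> 1 \<and> \<delta> * real n powr \<epsilon> \<ge> y) sequentially"
      by (intro eventually_conj eventually_ge_at_top) (simp add: filterlim_at_top)
    then obtain n where n: "n \<ge> 1" "\<delta> * real n powr \<epsilon> \<ge> y"
      using eventually_happens'[OF sequentially_bot] by blast
    then show ?thesis
      using \<delta>(3)[OF n(1)] by (intro exI[of _ n]) simp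
  qed
  obtain R where R: "\<And>x. x \<ge> R \<Longrightarrow> c * x powr \<alpha> \<le> sqrt x"
    using powr_le_sqrt_eventually[OF alpha(2), of c] by (auto simp: eventually_at_top_linorder)
  obtain \<mu> where \<mu>: "\<And>j. \<mu> j \<in> ev ` {1..}" "\<And>j. max 1 R \<le> \<mu> j" "\<And>j. C * \<mu> j \<le> \<mu> (Suc j)"
      "\<And>j. \<mu> (Suc j) \<le> C\<^sup>2 * \<mu> j"
    using lacunary_sequence_exists[of 1 ev C "max 1 R", OF C(2) C(1) unbounded] by blast
  have "\<exists>x \<in> eigenspace D A (\<mu> j). norm x = 1" for j
  proof -
    have "\<mu> j \<in> eigenvalues D A"
      using \<mu>(1)[of j] eigenvalue_sequence_in_eigenvalues[OF ev] by auto
    then obtain x where "x \<in> eigenspace D A (\<mu> j)" "x \<noteq> 0"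
      by (auto simp: eigenvalues_def)
    then show ?thesis
      using subspace_eigenspace[OF sa] by (intro bexI[of _ "x /\<^sub>R norm x"]) (auto simp: subspace_scale)
  qed
  then obtain e where e: "\<And>j. e j \<in> eigenspace D A (\<mu> j)" "\<And>j. norm (e j) = 1"
    by metis
  have "\<mu> j < \<mu> (Suc j)" for j
  proof -
    have "1 * \<mu> j < C * \<mu> j"
      using \<mu>(2)[of j] C(1) by (intro mult_strict_right_mono) auto
    then show ?thesis
      using \<mu>(3)[of j] by simp
  qed
  then have "inj \<mu>"
    by (intro strict_mono_imp_inj_on) (simp add: strict_mono_Suc_iff)
  interpret damped_modes D A \<mu> e c \<alpha> C
    by unfold_locales
      (use sa coer eigenvalue_sequence_eigenspace_finite[OF ev] \<open>inj \<mu>\<close> e c alpha C(1) \<mu>(2)[of 0] \<mu>(2,3) R in auto)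
  define \<delta> where "\<delta> t \<theta> = (exp (- (c * \<theta> + 4/\<alpha>) * (C\<^sup>2 * max (\<mu> 0) (16 / (\<theta> - t)\<^sup>2)) powr \<alpha>)
      * min 1 ((\<theta> - t) / 4)) powr (\<alpha>/2)" for t \<theta>
  have sol: "energy_solution D A c \<alpha> (eigen_series (cosine_mode 0)) (eigen_series (mode_deriv 0)) (\<lambda>t. eigen_series (cosine_mode t))"
    using alpha by (intro energy_solution_modes) simp
  moreover from this have "eigen_series (cosine_mode 0) \<in> frac_power_domain D A (1/2)"
    by (auto simp: energy_solution_def)
  moreover have "(\<delta> t \<theta> * real k) powr (2 * real k / \<alpha>)
      \<le> integral {t..\<theta>} (\<lambda>s. (norm ((A ^^ k) (eigen_series (cosine_mode s))))\<^sup>2)"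
    if "k \<ge> 1" "0 < t" "t < \<theta>" for k t \<theta>
    unfolding \<delta>_def using that \<mu>(4) C(1) by (intro integral_operator_power_lower_bound) auto
  moreover have "\<delta> t \<theta> > 0" if "0 < t" "t < \<theta>" for t \<theta>
    using that by (auto simp: \<delta>_def min_def)
  ultimately show ?thesis
    using operator_power_modes(1)
    by (intro exI[of _ "eigen_series (cosine_mode 0)"] exI[of _ "eigen_series (mode_deriv 0)"]
        exI[of _ "\<lambda>t. eigen_series (cosine_mode t)"] exI[of _ "1::nat"] exI[of _ \<delta>]) auto
qed

end
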